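(* Let $G=(V(G),E(G))$ be a connected signed graph with at least $2$ vertices and at least one negative cycle, and let $t\geq 1$ be an integer. If there exists an edge set $F_0\subseteq E(G)$ with $|E(G)|-|F_0|<t\cdot b(F_0)$, then $ar_{\pm}(G,t)=|E(G)|$. Otherwise, $$ar_{\pm}(G,t)=\max_{F\colon b(F)\geq 2}\{|F|+t\,(b(F)-1)\},$$ where the maximum is taken over all edge sets $F\subseteq E(G)$ with $b(F)\geq 2$.
   Context: A signed graph is a multigraph in which each edge has sign $+$ or $-$; a cycle is positive or negative according to the product of the signs of its edges. A subgraph is balanced if every cycle in it is positive. For $F\subseteq E(G)$, $b(F)$ is the number of balanced connected components of the spanning subgraph $(V(G),F)$ (isolated vertices count as balanced components). A signed unicyclic subgraph is a spanning subgraph of $G$ each of whose connected components contains exactly one cycle, and that cycle is negative. Given a coloring of $E(G)$, a subgraph is rainbow if its edges have pairwise distinct colors. $ar_{\pm}(G,t)$ is the maximum number $m$ such that there is a coloring of $E(G)$ with exactly $m$ colors containing no $t$ pairwise edge-disjoint rainbow signed unicyclic subgraphs. *)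

theory Defs
  imports Main "HOL-Library.Disjoint_Sets"
begin

text \<open>
  Finite undirected multigraphs with signed edges.  Edges are abstract objects, so parallel
  edges are possible; \<open>ends e\<close> is the set of end vertices of \<open>e\<close>, a singleton if \<open>e\<close> is a loop.
  A spanning subgraph is represented by its edge set.
\<close>

record ('v, 'e) sgraph =
  vertices :: "'v set"
  edges :: "'e set"
  ends :: "'e \<Rightarrow> 'v set"
  edge_sign :: "'e \<Rightarrow> int"

definition signed_graph :: "('v, 'e) sgraph \<Rightarrow> bool" where
  "signed_graph G \<longleftrightarrow>
     finite (vertices G) \<and> finite (edges G) \<and>
     (\<forall>e\<in>edges G. \<exists>u\<in>vertices G. \<exists>v\<in>vertices G. ends G e = {u, v}) \<and>
     (\<forall>e\<in>edges G. edge_sign G e \<in> {1, - 1})"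

definition adjacency :: "('v, 'e) sgraph \<Rightarrow> 'e set \<Rightarrow> 'v rel" where
  "adjacency G F = {(u, v). \<exists>e\<in>F. ends G e = {u, v}}"

definition reachability :: "('v, 'e) sgraph \<Rightarrow> 'e set \<Rightarrow> 'v rel" where
  "reachability G F = {(u, v). u \<in> vertices G \<and> v \<in> vertices G \<and> (u, v) \<in> (adjacency G F)\<^sup>*}"

definition connected_graph :: "('v, 'e) sgraph \<Rightarrow> bool" where
  "connected_graph G \<longleftrightarrow>
     vertices G \<noteq> {} \<and> (\<forall>u\<in>vertices G. \<forall>v\<in>vertices G. (u, v) \<in> reachability G (edges G))"

text \<open>The vertex sets of the connected components of the spanning subgraph with edge set \<open>F\<close>.\<close>

definition graph_components :: "('v, 'e) sgraph \<Rightarrow> 'e set \<Rightarrow> 'v set set" where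
  "graph_components G F = vertices G // reachability G F"

definition edges_within :: "('v, 'e) sgraph \<Rightarrow> 'e set \<Rightarrow> 'v set \<Rightarrow> 'e set" where
  "edges_within G F W = {e \<in> F. ends G e \<subseteq> W}"

text \<open>
  A cycle is identified with its edge set.  Length 1 is a loop, length 2 a pair of distinct
  parallel edges.
\<close>

definition is_cycle :: "('v, 'e) sgraph \<Rightarrow> 'e set \<Rightarrow> bool" where
  "is_cycle G C \<longleftrightarrow>
     C \<subseteq> edges G \<and>
     (\<exists>vs es. es \<noteq> [] \<and> length vs = length es \<and> distinct vs \<and> distinct es \<and>
        set vs \<subseteq> vertices G \<and> set es = C \<and>
        (\<forall>i<length es. ends G (es ! i) = {vs ! i, vs ! (Suc i mod length es)}))"

definition cycle_sign :: "('v, 'e) sgraph \<Rightarrow> 'e set \<Rightarrow> int" where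
  "cycle_sign G C = (\<Prod>e\<in>C. edge_sign G e)"

definition positive_cycle :: "('v, 'e) sgraph \<Rightarrow> 'e set \<Rightarrow> bool" where
  "positive_cycle G C \<longleftrightarrow> is_cycle G C \<and> cycle_sign G C = 1"

definition negative_cycle :: "('v, 'e) sgraph \<Rightarrow> 'e set \<Rightarrow> bool" where
  "negative_cycle G C \<longleftrightarrow> is_cycle G C \<and> cycle_sign G C = - 1"

definition balanced :: "('v, 'e) sgraph \<Rightarrow> 'e set \<Rightarrow> bool" where
  "balanced G F \<longleftrightarrow> (\<forall>C. is_cycle G C \<and> C \<subseteq> F \<longrightarrow> positive_cycle G C)"

definition num_balanced :: "('v, 'e) sgraph \<Rightarrow> 'e set \<Rightarrow> nat" where
  "num_balanced G F = card {W \<in> graph_components G F. balanced G (edges_within G F W)}"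

definition signed_unicyclic :: "('v, 'e) sgraph \<Rightarrow> 'e set \<Rightarrow> bool" where
  "signed_unicyclic G U \<longleftrightarrow>
     U \<subseteq> edges G \<and>
     (\<forall>W\<in>graph_components G U.
        (\<exists>!C. is_cycle G C \<and> C \<subseteq> edges_within G U W) \<and>
        (\<forall>C. is_cycle G C \<and> C \<subseteq> edges_within G U W \<longrightarrow> negative_cycle G C))"

definition rainbow :: "('e \<Rightarrow> nat) \<Rightarrow> 'e set \<Rightarrow> bool" where
  "rainbow c U \<longleftrightarrow> inj_on c U"

definition has_disjoint_rainbow :: "('v, 'e) sgraph \<Rightarrow> ('e \<Rightarrow> nat) \<Rightarrow> nat \<Rightarrow> bool" where
  "has_disjoint_rainbow G c t \<longleftrightarrow>
     (\<exists>U :: nat \<Rightarrow> 'e set.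
        (\<forall>i<t. signed_unicyclic G (U i) \<and> rainbow c (U i)) \<and> disjoint_family_on U {..<t})"

text \<open>
  The set below is bounded by the number of edges, hence finite.  It is nonempty whenever
  \<open>t \<ge> 1\<close> and \<open>G\<close> has at least two vertices: a constant coloring has no rainbow subgraph with
  two or more edges, and a signed unicyclic subgraph has as many edges as \<open>G\<close> has vertices.
\<close>

definition anti_ramsey :: "('v, 'e) sgraph \<Rightarrow> nat \<Rightarrow> nat" where
  "anti_ramsey G t =
     Max {m. \<exists>c :: 'e \<Rightarrow> nat. card (c ` edges G) = m \<and> \<not> has_disjoint_rainbow G c t}"

end

theory Submission
  imports Defs "HOL-Library.Numeral_Type" "HOL-Library.FuncSet" "HOL-Library.Function_Algebras"
begin

text \<open>
  Signed unicyclic subgraphs are the bases of the signed-graphic matroid, whose rank function is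
  \<open>card (vertices G) - num_balanced G F\<close>; submodularity follows because \<open>num_balanced G F\<close> is the
  dimension over the field with three elements of the space of vertex labellings \<open>x\<close> with
  \<open>x u = \<sigma> e * x v\<close> for every edge \<open>e\<close> of \<open>F\<close> joining \<open>u\<close> and \<open>v\<close>.

  For the upper bound, let \<open>n\<close> be the rank. Two applications of Rado's theorem on independent
  transversals give \<open>t\<close> disjoint bases whose union, of size \<open>t * n\<close>, carries more than \<open>t * n - t\<close>
  colours. With so few repetitions, symmetric exchanges between the bases make all of them rainbow.
\<close>

section \<open>Disjoint rainbow bases in matroids\<close>

text \<open>Write \<open>b F\<close> for \<open>num_balanced G F\<close>, so that \<open>F\<close>
  has rank \<open>n - b F\<close>. The Hall-type condition on colours then says that more than
  \<open>t * (b F - 1)\<close> colours occur outside \<open>F\<close>. It is void for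
  \<open>b F = 0\<close>, asks for one colour outside \<open>F\<close> when \<open>b F = 1\<close>,
  and for \<open>b F \<ge> 2\<close> follows once there are more than
  \<open>card F + t * (b F - 1)\<close> colours in all. This is the origin of the range of the
  maximum.

  The obstacle is that a colour may recur in different bases but not within one: a constraint per
  base, on top of independence, that Rado's theorem does not handle. So the colours are first
  counted globally with one representative each, the bases are completed without regard to colours,
  and repetitions are repaired last.

  The field must have \<open>1 \<noteq> - 1\<close>, so that a negative cycle forces zero labels,
  and must be finite, so that dimensions can be compared by counting solutions.\<close>

text \<open>
  Rado's theorem in Welsh's form: a family of sets with a spare element can always be shrunk, by one
  of two given elements, without violating the Hall condition for a submodular function.
\<close>
lemma submodular_transversal:
  fixes f :: "'a set \<Rightarrow> nat" and X :: "'i \<Rightarrow> 'a set"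
  assumes mono: "\<And>A B. A \<subseteq> B \<Longrightarrow> f A \<le> f B"
    and submod: "\<And>A B. f (A \<union> B) + f (A \<inter> B) \<le> f A + f B"
    and "finite I"
    and "\<And>i. i \<in> I \<Longrightarrow> finite (X i)" "\<And>i. i \<in> I \<Longrightarrow> X i \<noteq> {}"
    and "\<And>K. K \<subseteq> I \<Longrightarrow> card K \<le> f (\<Union>i\<in>K. X i)"
  shows "\<exists>x. (\<forall>i\<in>I. x i \<in> X i) \<and> (\<forall>K\<subseteq>I. card K \<le> f (x ` K))"
  using assms(4-6)
proof (induction "\<Sum>i\<in>I. card (X i)" arbitrary: X rule: less_induct)
  case less
  show ?case
  proof (cases "\<exists>j\<in>I. \<exists>a\<in>X j. \<exists>b\<in>X j. a \<noteq> b")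
    case False
    then have "\<forall>i\<in>I. \<exists>y. X i = {y}"
      using less.prems(2) by blast
    then obtain x where x: "\<forall>i\<in>I. X i = {x i}"
      by metis
    have "(\<Union>i\<in>K. X i) = x ` K" if "K \<subseteq> I" for K
      using that x by auto
    then show ?thesis
      using x less.prems(3) by (intro exI[of _ x]) auto
  next
    case True
    then obtain j a b where j: "j \<in> I" "a \<in> X j" "b \<in> X j" "a \<noteq> b"
      by blast
    define Y where "Y z = X(j := X j - {z})" for z
    have "\<exists>z\<in>{a, b}. \<forall>K\<subseteq>I. card K \<le> f (\<Union>i\<in>K. Y z i)"
    proof (rule ccontr)
      assume "\<not> ?thesis"
      then obtain K L where K: "K \<subseteq> I" "f (\<Union>i\<in>K. Y a i) < card K"
        and L: "L \<subseteq> I" "f (\<Union>i\<in>L. Y b i) < card L"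
        by (auto simp: not_le)
      have fin: "finite K" "finite L"
        using K L \<open>finite I\<close> finite_subset by auto
      have untouched: "j \<in> M" if "M \<subseteq> I" "f (\<Union>i\<in>M. Y z i) < card M" for M z
      proof (rule ccontr)
        assume "j \<notin> M"
        then have "(\<Union>i\<in>M. Y z i) = (\<Union>i\<in>M. X i)"
          by (auto simp: Y_def)
        then show False
          using that less.prems(3)[of M] by simp
      qed
      have jKL: "j \<in> K" "j \<in> L"
        using untouched K L by blast+
      \<comment> \<open>Both shrunken families agree with \<open>X\<close> away from
        \<open>j\<close>, and at \<open>j\<close> they jointly cover \<open>X j\<close> because
        \<open>a \<noteq> b\<close>. So \<open>?A \<union> ?B\<close> serves all of
        \<open>K \<union> L\<close>, while \<open>?A \<inter> ?B\<close> serves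
        \<open>K \<inter> L\<close> except for \<open>j\<close>. That exception costs one, but the
        two strict violations together gain two.\<close>
      let ?A = "\<Union>i\<in>K. Y a i" and ?B = "\<Union>i\<in>L. Y b i"
      have "(\<Union>i\<in>K \<union> L. X i) \<subseteq> ?A \<union> ?B"
      proof
        fix y assume "y \<in> (\<Union>i\<in>K \<union> L. X i)"
        then obtain i where i: "i \<in> K \<union> L" "y \<in> X i"
          by blast
        show "y \<in> ?A \<union> ?B"
        proof (cases "i = j")
          case True
          then have "y \<in> Y a j \<or> y \<in> Y b j"
            using i j(4) by (auto simp: Y_def)
          then show ?thesis
            using jKL by blast
        next
          case False
          then have "y \<in> Y a i" "y \<in> Y b i"
            using i by (auto simp: Y_def)
          then show ?thesis
            using i by blast
        qed
      qed
      then have "card (K \<union> L) \<le> f (?A \<union> ?B)"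
        using less.prems(3)[of "K \<union> L"] K L mono le_trans by (metis Un_subset_iff)
      moreover have "(\<Union>i\<in>K \<inter> L - {j}. X i) \<subseteq> ?A \<inter> ?B"
        by (fastforce simp: Y_def)
      then have "card (K \<inter> L - {j}) \<le> f (?A \<inter> ?B)"
        using less.prems(3)[of "K \<inter> L - {j}"] K mono
        by (meson Diff_subset Int_lower1 le_trans subset_trans)
      then have "card (K \<inter> L) \<le> Suc (f (?A \<inter> ?B))"
        using jKL fin by (simp add: card_Diff_singleton)
      moreover have "card (K \<union> L) + card (K \<inter> L) = card K + card L"
        using card_Un_Int[OF fin] by simp
      ultimately show False
        using submod[of ?A ?B] K(2) L(2) by linarith
    qed
    then obtain z where z: "z \<in> {a, b}" "\<And>K. K \<subseteq> I \<Longrightarrow> card K \<le> f (\<Union>i\<in>K. Y z i)"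
      by blast
    have Y_sub: "Y z i \<subseteq> X i" for i
      by (auto simp: Y_def)
    have "(\<Sum>i\<in>I. card (Y z i)) < (\<Sum>i\<in>I. card (X i))"
    proof (rule sum_strict_mono_ex1[OF \<open>finite I\<close>])
      show "\<forall>i\<in>I. card (Y z i) \<le> card (X i)"
        using Y_sub less.prems(1) by (simp add: card_mono)
      show "\<exists>i\<in>I. card (Y z i) < card (X i)"
        using j z(1) less.prems(1)
        by (intro bexI[of _ j]) (auto simp: Y_def intro: card_Diff1_less simp del: card_Diff_insert)
    qed
    moreover have "finite (Y z i)" "Y z i \<noteq> {}" if "i \<in> I" for i
      using that less.prems(1,2) Y_sub j(2-4) z(1) by (auto simp: Y_def)
    ultimately obtain x where "\<forall>i\<in>I. x i \<in> Y z i" "\<forall>K\<subseteq>I. card K \<le> f (x ` K)"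
      using less.hyps[of "Y z"] z(2) by blast
    then show ?thesis
      using Y_sub by blast
  qed
qed

section \<open>Matroids described by their rank function\<close>

text \<open>No ground set is fixed. A finite set is independent when \<open>r A = card A\<close>,
  and a base of a rank-\<open>n\<close> matroid is a set with cardinality and rank both equal to
  \<open>n\<close>.\<close>

locale matroid_rank =
  fixes r :: "'e set \<Rightarrow> nat"
  assumes rank_empty: "r {} = 0"
    and rank_singleton_le: "r {e} \<le> 1"
    and rank_mono: "A \<subseteq> B \<Longrightarrow> r A \<le> r B"
    and rank_submodular: "r (A \<union> B) + r (A \<inter> B) \<le> r A + r B"
begin

lemma rank_Un_le: "r (A \<union> B) \<le> r A + r B"
  using rank_submodular[of A B] by linarith

lemma rank_insert_ge: "r A \<le> r (insert e A)"
  by (rule rank_mono) blast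

lemma rank_insert_le: "r (insert e A) \<le> Suc (r A)"
  using rank_Un_le[of "{e}" A] rank_singleton_le[of e] by simp

lemma rank_le_card: "finite A \<Longrightarrow> r A \<le> card A"
proof (induction A rule: finite_induct)
  case (insert e A)
  then show ?case
    using rank_insert_le[of e A] by simp
qed (simp add: rank_empty)

text \<open>Monotonicity of closure, read off from submodularity for \<open>insert e A\<close> and
  \<open>B\<close>.\<close>

lemma rank_insert_eq_superset:
  assumes "r (insert e A) = r A" "A \<subseteq> B"
  shows "r (insert e B) = r B"
proof -
  have "insert e A \<union> B = insert e B" "A \<subseteq> insert e A \<inter> B"
    using assms(2) by auto
  then have "r (insert e B) + r A \<le> r A + r B"
    using rank_submodular[of "insert e A" B] rank_mono[of A "insert e A \<inter> B"] assms(1) by simp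
  then show ?thesis
    using rank_insert_ge[of B e] by auto
qed

lemma rank_Un_eq:
  assumes "finite Z" "\<And>y. y \<in> Z \<Longrightarrow> r (insert y A) = r A"
  shows "r (A \<union> Z) = r A"
  using assms
proof (induction Z rule: finite_induct)
  case (insert y Z)
  then have "r (insert y (A \<union> Z)) = r (A \<union> Z)"
    using rank_insert_eq_superset[of y A "A \<union> Z"] by blast
  then show ?case
    using insert by simp
qed simp

lemma independent_subset:
  assumes "finite A" "r A = card A" "B \<subseteq> A"
  shows "r B = card B"
proof -
  have "A = B \<union> (A - B)"
    using assms(3) by blast
  then have "card A \<le> r B + r (A - B)"
    using rank_Un_le[of B "A - B"] assms(2) by simp
  moreover have "card A = card B + card (A - B)"
    using assms by (metis card_Diff_subset card_mono finite_subset le_add_diff_inverse)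
  ultimately show ?thesis
    using rank_le_card[of "A - B"] rank_le_card[of B] assms finite_subset[of B A] by simp
qed

lemma exists_basis:
  assumes "finite A"
  shows "\<exists>B\<subseteq>A. card B = r A \<and> r B = r A"
  using assms
proof (induction A rule: finite_induct)
  case (insert e A)
  then obtain B where B: "B \<subseteq> A" "card B = r A" "r B = r A"
    by blast
  show ?case
  proof (cases "r (insert e A) = r A")
    case True
    then show ?thesis
      using B by (metis subset_insertI2)
  next
    case False
    then have rA: "r (insert e A) = Suc (r A)"
      using rank_insert_le[of e A] rank_insert_ge[of A e] by auto
    have "r (insert e B) \<noteq> r B"
      using False B rank_insert_eq_superset by blast
    then have "r (insert e B) = Suc (r B)"
      using rank_insert_le[of e B] rank_insert_ge[of B e] by auto
    moreover have "card (insert e B) = Suc (card B)"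
      using B insert.hyps finite_subset by (metis card_insert_disjoint subsetD)
    ultimately show ?thesis
      using B rA by (intro exI[of _ "insert e B"]) auto
  qed
qed (simp add: rank_empty)

text \<open>The fundamental circuit of \<open>a\<close> in \<open>C\<close> cannot lie, apart from
  \<open>a\<close>, in the closure of \<open>B - {a}\<close>, since otherwise \<open>a\<close> would
  lie there too and \<open>B\<close> would be dependent. Any circuit element outside this closure
  can be exchanged in both directions.\<close>

lemma symmetric_exchange:
  assumes B: "finite B" "card B = n" "r B = n"
    and C: "finite C" "card C = n" "r C = n"
    and le_n: "\<And>A. r A \<le> n"
    and a: "a \<in> B" "a \<notin> C"
  shows "\<exists>y\<in>C. r (insert y (B - {a})) = n \<and> r (insert a (C - {y})) = n"
proof -
  \<comment> \<open>\<open>insert a Z\<close> is the fundamental circuit of \<open>a\<close> with respect to \<open>C\<close>.\<close>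
  have "r (insert a C) = r C"
    using C le_n rank_insert_ge[of C a] by (simp add: antisym)
  then obtain Z where Z: "Z \<subseteq> C" "r (insert a Z) = r Z"
    and Z_min: "\<And>Z'. Z' \<subset> Z \<Longrightarrow> r (insert a Z') \<noteq> r Z'"
  proof -
    define S where "S = {Z. Z \<subseteq> C \<and> r (insert a Z) = r Z}"
    have "finite S" "S \<noteq> {}"
      using C(1) \<open>r (insert a C) = r C\<close> by (auto simp: S_def)
    then obtain Z where "Z \<in> S" and Z_min: "\<And>Z'. Z' \<in> S \<Longrightarrow> Z' \<subseteq> Z \<Longrightarrow> Z = Z'"
      using finite_has_minimal[of S] by auto
    then have Z: "Z \<subseteq> C" "r (insert a Z) = r Z"
      by (auto simp: S_def)
    show ?thesis
    proof (rule that)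
      show "Z \<subseteq> C" "r (insert a Z) = r Z"
        using Z by auto
      show "r (insert a Z') \<noteq> r Z'" if "Z' \<subset> Z" for Z'
        using that Z Z_min[of Z'] unfolding S_def by blast
    qed
  qed
  have finZ: "finite Z"
    using Z C finite_subset by blast
  \<comment> \<open>By minimality of \<open>Z\<close>, \<open>insert a (Z - {z})\<close> has rank at
    least \<open>r Z\<close>. It is the intersection of \<open>insert a (C - {z})\<close> and
    \<open>insert a Z\<close>, whose union has rank \<open>n\<close>; submodularity thus excludes a
    rank drop of the first set.\<close>
  have swap: "r (insert a (C - {z})) = n" if z: "z \<in> Z" for z
  proof (rule ccontr)
    assume "r (insert a (C - {z})) \<noteq> n"
    then have lt: "r (insert a (C - {z})) < n"
      using le_n by (simp add: le_neq_implies_less)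
    have "r (Z - {z}) = card (Z - {z})" "r Z = card Z"
      using independent_subset[OF C(1), of "Z - {z}"] independent_subset[OF C(1), of Z] C Z by auto
    moreover have "r (insert a (Z - {z})) \<noteq> r (Z - {z})"
      using Z_min z by blast
    then have "Suc (r (Z - {z})) \<le> r (insert a (Z - {z}))"
      using rank_insert_ge[of "Z - {z}" a] by simp
    ultimately have "r Z \<le> r (insert a (Z - {z}))"
      using z finZ by (metis card_Suc_Diff1)
    moreover have "insert a (C - {z}) \<union> insert a Z = insert a C"
      "insert a (C - {z}) \<inter> insert a Z = insert a (Z - {z})"
      using z Z a by auto
    ultimately show False
      using rank_submodular[of "insert a (C - {z})" "insert a Z"] lt Z \<open>r (insert a C) = r C\<close> C
      by simp
  qed
  have "\<exists>y\<in>Z. r (insert y (B - {a})) = n"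
  proof (rule ccontr)
    assume *: "\<not> ?thesis"
    have rB: "r (B - {a}) = n - 1"
      using independent_subset[OF B(1), of "B - {a}"] B a by simp
    have "0 < n"
      using a B card_gt_0_iff by blast
    have "r (insert y (B - {a})) = r (B - {a})" if "y \<in> Z" for y
    proof -
      have "r (insert y (B - {a})) < n"
        using * that le_n le_neq_implies_less by blast
      then show ?thesis
        using rB rank_insert_ge[of "B - {a}" y] by simp
    qed
    then have "r (B - {a} \<union> Z) = n - 1"
      using rank_Un_eq[OF finZ, of "B - {a}"] rB by simp
    moreover have "r (insert a (B - {a} \<union> Z)) = r (B - {a} \<union> Z)"
      using Z rank_insert_eq_superset by blast
    moreover have "B \<subseteq> insert a (B - {a} \<union> Z)"
      by blast
    ultimately show False
      using rank_mono B \<open>0 < n\<close> by (metis Suc_n_not_le_n Suc_pred')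
  qed
  then show ?thesis
    using swap Z by blast
qed

section \<open>Packing independent sets by transversals\<close>

text \<open>The sum is the rank function of a direct sum of copies of the matroid, one per index in
  \<open>T\<close>. A transversal of pairs thus distributes elements over several independent sets
  at once.\<close>

lemma sum_sections_submodular:
  fixes A B :: "('e \<times> 'i) set"
  shows "(\<Sum>i\<in>T. r {e. (e, i) \<in> A \<union> B}) + (\<Sum>i\<in>T. r {e. (e, i) \<in> A \<inter> B})
    \<le> (\<Sum>i\<in>T. r {e. (e, i) \<in> A}) + (\<Sum>i\<in>T. r {e. (e, i) \<in> B})"
proof -
  have "{e. (e, i) \<in> A \<union> B} = {e. (e, i) \<in> A} \<union> {e. (e, i) \<in> B}"
    "{e. (e, i) \<in> A \<inter> B} = {e. (e, i) \<in> A} \<inter> {e. (e, i) \<in> B}" for i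
    by auto
  then show ?thesis
    by (simp add: sum.distrib[symmetric] sum_mono rank_submodular)
qed

lemma sum_sections_mono:
  fixes A B :: "('e \<times> 'i) set"
  shows "A \<subseteq> B \<Longrightarrow> (\<Sum>i\<in>T. r {e. (e, i) \<in> A}) \<le> (\<Sum>i\<in>T. r {e. (e, i) \<in> B})"
  by (intro sum_mono rank_mono) auto

text \<open>Here the index set of the transversal is the set of colours: each colour chooses one
  element together with the copy it goes to. Elements in different copies are then automatically
  distinct, and counting chosen elements is the same as counting colours.\<close>

lemma disjoint_independent_many_colours:
  fixes c :: "'e \<Rightarrow> 'c"
  assumes "finite E"
    and colours: "\<And>F. F \<subseteq> E \<Longrightarrow> k \<le> t * r F + card (c ` (E - F))"
    and "t \<ge> 1"
  shows "\<exists>J. (\<forall>i<t. J i \<subseteq> E \<and> r (J i) = card (J i)) \<and> disjoint_family_on J {..<t} \<and>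
    k \<le> card (c ` (\<Union>i<t. J i))"
proof -
  let ?m = "card (c ` E)"
  \<comment> \<open>The defect: only \<open>k\<close> of the \<open>?m\<close> colours have to be
    accounted for by rank. Adding this constant to the rank function keeps it monotone and
    submodular.\<close>
  define d where "d = ?m - k"
  define X where "X k = {(e, i). e \<in> E \<and> c e = k \<and> i < t}" for k
  define f where "f Y = (\<Sum>i<t. r {e. (e, i) \<in> Y}) + d" for Y :: "('e \<times> nat) set"
  have k_le: "k \<le> ?m"
    using colours[of "{}"] by (simp add: rank_empty)
  have "\<exists>x. (\<forall>k\<in>c ` E. x k \<in> X k) \<and> (\<forall>K\<subseteq>c ` E. card K \<le> f (x ` K))"
  proof (rule submodular_transversal)
    show "f A \<le> f B" if "A \<subseteq> B" for A B
      using sum_sections_mono[OF that] by (simp add: f_def)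
    show "f (A \<union> B) + f (A \<inter> B) \<le> f A + f B" for A B
      using sum_sections_submodular[where T = "{..<t}" and A = A and B = B] by (simp add: f_def)
    show "finite (c ` E)"
      using \<open>finite E\<close> by simp
    show "finite (X k)" for k
      by (rule finite_subset[of _ "E \<times> {..<t}"]) (use \<open>finite E\<close> in \<open>auto simp: X_def\<close>)
    show "X k \<noteq> {}" if "k \<in> c ` E" for k
      using that \<open>t \<ge> 1\<close> by (auto simp: X_def intro!: exI[of _ "0::nat"])
    \<comment> \<open>For a set \<open>K\<close> of colours, every section is the full set
      \<open>?F\<close> of elements coloured from \<open>K\<close>, and the colours off
      \<open>?F\<close> are exactly those outside \<open>K\<close>; the hypothesis at
      \<open>?F\<close> is the Hall condition at \<open>K\<close>.\<close>
    show "card K \<le> f (\<Union>k\<in>K. X k)" if K: "K \<subseteq> c ` E" for K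
    proof -
      let ?F = "{e \<in> E. c e \<in> K}"
      have "{e. (e, i) \<in> (\<Union>k\<in>K. X k)} = ?F" if "i < t" for i
        using that by (auto simp: X_def)
      then have "f (\<Union>k\<in>K. X k) = t * r ?F + d"
        by (simp add: f_def)
      moreover have "c ` (E - ?F) = c ` E - K"
        by auto
      then have "card (c ` (E - ?F)) = ?m - card K" "card K \<le> ?m"
        using K \<open>finite E\<close> by (auto simp: card_Diff_subset finite_subset card_mono)
      ultimately show ?thesis
        using colours[of ?F] k_le by (auto simp: d_def)
    qed
  qed
  then obtain x where x: "\<And>k. k \<in> c ` E \<Longrightarrow> x k \<in> X k" and "?m \<le> f (x ` c ` E)"
    by blast
  define Y where "Y i = {e. (e, i) \<in> x ` c ` E}" for i
  have Y: "e \<in> E \<and> x (c e) = (e, i)" if "e \<in> Y i" for e i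
    using that x by (fastforce simp: Y_def X_def)
  have finY: "finite (Y i)" for i
    by (rule finite_subset[OF _ \<open>finite E\<close>]) (use Y in blast)
  have "k \<le> (\<Sum>i<t. r (Y i))"
    using \<open>?m \<le> f (x ` c ` E)\<close> k_le by (simp add: f_def d_def Y_def)
  \<comment> \<open>Because of the defect, \<open>Y i\<close> may be dependent. Only its rank enters
    the count, so nothing is lost by passing to a maximal independent subset.\<close>
  have "\<forall>i. \<exists>B\<subseteq>Y i. card B = r (Y i) \<and> r B = r (Y i)"
    using exists_basis finY by blast
  then obtain J where J: "\<And>i. J i \<subseteq> Y i" "\<And>i. card (J i) = r (Y i)" "\<And>i. r (J i) = r (Y i)"
    by metis
  have disj: "disjoint_family_on J {..<t}"
    unfolding disjoint_family_on_def
  proof (intro ballI impI equals0I)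
    fix i j e assume "i \<noteq> j" "e \<in> J i \<inter> J j"
    then have "e \<in> Y i" "e \<in> Y j"
      using J(1) by auto
    then show False
      using Y[of e i] Y[of e j] \<open>i \<noteq> j\<close> by simp
  qed
  have "inj_on c (\<Union>i<t. J i)"
    by (rule inj_onI) (use J(1) Y in \<open>metis UN_E fst_conv subsetD\<close>)
  then have "card (c ` (\<Union>i<t. J i)) = card (\<Union>i<t. J i)"
    by (rule card_image)
  also have "\<dots> = (\<Sum>i<t. card (J i))"
    using disj J(1) finY by (intro card_UN_disjoint') (auto intro: finite_subset)
  finally have "k \<le> card (c ` (\<Union>i<t. J i))"
    using J \<open>k \<le> (\<Sum>i<t. r (Y i))\<close> by simp
  then show ?thesis
    using J Y disj by (intro exI[of _ J]) (metis subset_iff)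
qed

text \<open>
  The transversal assigns each element of \<open>E\<close> to one of the \<open>t\<close> bases or to a bin (index \<open>t\<close>)
  of capacity \<open>card E - t * n\<close>; elements of the given independent sets are barred from the bin.
\<close>
lemma extend_to_disjoint_bases:
  assumes "finite E"
    and le_n: "\<And>A. r A \<le> n"
    and pack: "\<And>F. F \<subseteq> E \<Longrightarrow> t * n \<le> t * r F + card (E - F)"
    and J: "\<And>i. i < t \<Longrightarrow> J i \<subseteq> E" "\<And>i. i < t \<Longrightarrow> r (J i) = card (J i)"
    and "t \<ge> 1"
  shows "\<exists>U. (\<forall>i<t. U i \<subseteq> E \<and> card (U i) = n \<and> r (U i) = n) \<and> disjoint_family_on U {..<t} \<and>
    (\<Union>i<t. J i) \<subseteq> (\<Union>i<t. U i)"
proof -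
  define R where "R = (\<Union>i<t. J i)"
  define d where "d = card E - t * n"
  define X where "X e = {(e, i) |i. i < t \<or> i = t \<and> e \<notin> R}" for e
  \<comment> \<open>The \<open>min\<close> term is the rank function of a uniform matroid of rank
    \<open>d\<close>, which models the bin as one more summand.\<close>
  define f where "f Y = (\<Sum>i<t. r {e. (e, i) \<in> Y}) + min d (card {e \<in> E. (e, t) \<in> Y})"
    for Y :: "('e \<times> nat) set"
  have tn_le: "t * n \<le> card E"
    using pack[of "{}"] by (simp add: rank_empty)
  have R_le: "card (F \<inter> R) \<le> t * r F" for F
  proof -
    have "F \<inter> R = (\<Union>i<t. F \<inter> J i)"
      by (auto simp: R_def)
    then have "card (F \<inter> R) = card (\<Union>i<t. F \<inter> J i)"
      by (rule arg_cong)
    also have "\<dots> \<le> (\<Sum>i<t. card (F \<inter> J i))"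
      by (rule card_UN_le) simp
    also have "\<dots> \<le> (\<Sum>i<t. r F)"
    proof (rule sum_mono)
      fix i assume "i \<in> {..<t}"
      then have "r (F \<inter> J i) = card (F \<inter> J i)"
        using J[of i] independent_subset[of "J i" "F \<inter> J i"] finite_subset[OF _ \<open>finite E\<close>] by simp
      then show "card (F \<inter> J i) \<le> r F"
        using rank_mono[of "F \<inter> J i" F] by simp
    qed
    finally show ?thesis
      by simp
  qed
  have "\<exists>x. (\<forall>e\<in>E. x e \<in> X e) \<and> (\<forall>K\<subseteq>E. card K \<le> f (x ` K))"
  proof (rule submodular_transversal)
    show "f A \<le> f B" if "A \<subseteq> B" for A B
    proof -
      have "card {e \<in> E. (e, t) \<in> A} \<le> card {e \<in> E. (e, t) \<in> B}"
        using that \<open>finite E\<close> by (intro card_mono) auto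
      then show ?thesis
        using sum_sections_mono[OF that, where T = "{..<t}"] unfolding f_def by linarith
    qed
    show "f (A \<union> B) + f (A \<inter> B) \<le> f A + f B" for A B
    proof -
      let ?S = "\<lambda>Y. {e \<in> E. (e, t) \<in> Y}"
      have "?S (A \<union> B) = ?S A \<union> ?S B" "?S (A \<inter> B) = ?S A \<inter> ?S B"
        by auto
      then have "card (?S (A \<union> B)) + card (?S (A \<inter> B)) = card (?S A) + card (?S B)"
        using card_Un_Int[of "?S A" "?S B"] \<open>finite E\<close> by simp
      moreover have "card (?S (A \<inter> B)) \<le> card (?S A)" "card (?S (A \<inter> B)) \<le> card (?S B)"
        using \<open>finite E\<close> by (auto intro!: card_mono)
      ultimately show ?thesis
        using sum_sections_submodular[where T = "{..<t}" and A = A and B = B] unfolding f_def by linarith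
    qed
    show "finite E"
      by fact
    show "finite (X e)" for e
      by (rule finite_subset[of _ "{e} \<times> {..t}"]) (auto simp: X_def)
    show "X e \<noteq> {}" for e
      using \<open>t \<ge> 1\<close> by (auto simp: X_def intro!: exI[of _ "0::nat"])
    \<comment> \<open>If the bin is saturated, the bound is \<open>pack\<close>. Otherwise it
      absorbs all of \<open>K - R\<close>, and \<open>R_le\<close> takes care of
      \<open>K \<inter> R\<close>.\<close>
    show "card K \<le> f (\<Union>e\<in>K. X e)" if K: "K \<subseteq> E" for K
    proof -
      have "{e. (e, i) \<in> (\<Union>e\<in>K. X e)} = K" if "i < t" for i
        using that by (auto simp: X_def)
      moreover have "{e \<in> E. (e, t) \<in> (\<Union>e\<in>K. X e)} = K - R"
        using K by (auto simp: X_def)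
      ultimately have "f (\<Union>e\<in>K. X e) = t * r K + min d (card (K - R))"
        by (simp add: f_def)
      moreover have finK: "finite K"
        using K \<open>finite E\<close> finite_subset by blast
      then have "card K = card (K \<inter> R) + card (K - R)"
        by (metis card_Int_Diff)
      moreover have "card (E - K) = card E - card K" "card K \<le> card E"
        using K \<open>finite E\<close> finK by (auto simp: card_Diff_subset card_mono)
      ultimately show ?thesis
        using R_le[of K] pack[OF K] tn_le unfolding d_def by linarith
    qed
  qed
  then obtain x where x: "\<And>e. e \<in> E \<Longrightarrow> x e \<in> X e"
    and x_card: "\<And>K. K \<subseteq> E \<Longrightarrow> card K \<le> f (x ` K)"
    by blast
  define U where "U i = {e \<in> E. x e = (e, i)}" for i
  have sec: "{e. (e, i) \<in> x ` K} = {e \<in> K. x e = (e, i)}" if "K \<subseteq> E" for K i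
  proof -
    have "fst (x e) = e" if "e \<in> K" for e
      using x[OF subsetD[OF \<open>K \<subseteq> E\<close> that]] by (auto simp: X_def)
    then have "x k = (e, i) \<Longrightarrow> k = e" if "k \<in> K" for k e
      using that by (metis fst_conv)
    then show ?thesis
      by (metis (no_types, opaque_lifting) image_iff)
  qed
  \<comment> \<open>The Hall bound is used twice: at \<open>E\<close> it forces total rank
    \<open>t * n\<close>, hence full rank of every \<open>U i\<close>; at a single
    \<open>U i\<close> it forces independence, since the other copies and the bin contribute
    nothing.\<close>
  have "card E \<le> f (x ` E)"
    using x_card by blast
  also have "f (x ` E) \<le> (\<Sum>i<t. r (U i)) + d"
    by (simp add: f_def sec U_def)
  finally have "t * n \<le> (\<Sum>i<t. r (U i))"
    using tn_le by (simp add: d_def)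
  have rU: "r (U i) = n" if "i < t" for i
  proof (rule ccontr)
    assume "r (U i) \<noteq> n"
    then have "r (U i) < n"
      using le_n le_neq_implies_less by blast
    then have "(\<Sum>i<t. r (U i)) < (\<Sum>i<t. n)"
      using that le_n by (intro sum_strict_mono_ex1) auto
    then show False
      using \<open>t * n \<le> (\<Sum>i<t. r (U i))\<close> by simp
  qed
  have "card (U i) = n" if "i < t" for i
  proof -
    have "finite (U i)"
      using \<open>finite E\<close> by (simp add: U_def)
    have "U i \<subseteq> E"
      by (auto simp: U_def)
    have "{e \<in> U i. x e = (e, j)} = (if j = i then U i else {})" for j
      by (auto simp: U_def)
    moreover have "{e \<in> E. (e, t) \<in> x ` U i} = {}"
      using that by (auto simp: U_def)
    then have "card {e \<in> E. (e, t) \<in> x ` U i} = 0"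
      by (simp only: card.empty)
    ultimately have "f (x ` U i) = (\<Sum>j<t. if j = i then r (U i) else 0)"
      unfolding f_def by (simp add: sec[OF \<open>U i \<subseteq> E\<close>] if_distrib[of r] rank_empty cong: if_cong)
    also have "\<dots> = r (U i)"
      using that by simp
    finally have "card (U i) \<le> r (U i)"
      using x_card[OF \<open>U i \<subseteq> E\<close>] by simp
    then show ?thesis
      using rU[OF that] rank_le_card[OF \<open>finite (U i)\<close>] by simp
  qed
  \<comment> \<open>An element of \<open>R\<close> may land in a base other than the one suggested
    by its \<open>J i\<close>; the colour count needs only the union.\<close>
  moreover have "R \<subseteq> (\<Union>i<t. U i)"
  proof
    fix e assume "e \<in> R"
    then have "e \<in> E"
      using J by (auto simp: R_def)
    then show "e \<in> (\<Union>i<t. U i)"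
      using x[of e] \<open>e \<in> R\<close> by (auto simp: X_def U_def)
  qed
  moreover have "disjoint_family_on U {..<t}"
    by (auto simp: disjoint_family_on_def U_def)
  moreover have "U i \<subseteq> E" for i
    by (auto simp: U_def)
  ultimately show ?thesis
    using rU unfolding R_def by (intro exI[of _ U]) blast
qed

text \<open>
  Among the partitions of the union into bases, one maximising the total number of colours per base
  is rainbow: if \<open>V p\<close> repeats a colour, failure of every improving exchange with \<open>V j\<close> puts into
  \<open>V j\<close> an element with a colour of \<open>V p\<close>, so that at least \<open>t\<close> elements are redundant.
\<close>
lemma rainbow_bases_of_few_repetitions:
  fixes c :: "'e \<Rightarrow> 'c"
  assumes le_n: "\<And>A. r A \<le> n"
    and U: "\<And>i. i < t \<Longrightarrow> finite (U i) \<and> card (U i) = n \<and> r (U i) = n" "disjoint_family_on U {..<t}"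
    and colours: "t * n < card (c ` (\<Union>i<t. U i)) + t"
  shows "\<exists>V. (\<forall>i<t. card (V i) = n \<and> r (V i) = n \<and> inj_on c (V i)) \<and>
    disjoint_family_on V {..<t} \<and> (\<Union>i<t. V i) = (\<Union>i<t. U i)"
proof -
  define S where "S = (\<Union>i<t. U i)"
  define P where "P V \<longleftrightarrow> (\<forall>i<t. finite (V i) \<and> card (V i) = n \<and> r (V i) = n) \<and>
    disjoint_family_on V {..<t} \<and> (\<Union>i<t. V i) = S" for V
  define w where "w V = (\<Sum>i<t. card (c ` V i))" for V
  have "w V \<le> t * n" if "P V" for V
  proof -
    have "w V \<le> (\<Sum>i<t. n)"
      unfolding w_def using that by (intro sum_mono) (metis P_def card_image_le lessThan_iff)
    then show ?thesis
      by simp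
  qed
  moreover have "P U"
    using U by (simp add: P_def S_def)
  ultimately obtain V where "P V" and V_max: "\<And>V'. P V' \<Longrightarrow> w V' \<le> w V"
    using ex_has_greatest_nat[of P U w "Suc (t * n)"] by (auto simp: less_Suc_eq_le)
  then have V: "\<And>i. i < t \<Longrightarrow> finite (V i)" "\<And>i. i < t \<Longrightarrow> card (V i) = n"
    "\<And>i. i < t \<Longrightarrow> r (V i) = n"
    and V_disj: "disjoint_family_on V {..<t}" and V_Un: "(\<Union>i<t. V i) = S"
    by (auto simp: P_def)
  have disjD: "i = j" if "e \<in> V i" "e \<in> V j" "i < t" "j < t" for e i j
    using V_disj that by (auto simp: disjoint_family_on_def)
  have "inj_on c (V p)" if p: "p < t" for p
  proof (rule ccontr)
    assume "\<not> inj_on c (V p)"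
    then obtain a a' where a: "a \<in> V p" "a' \<in> V p" "a \<noteq> a'" "c a = c a'"
      by (auto simp: inj_on_def)
    have "\<exists>y\<in>V j. c y \<in> c ` V p" if j: "j < t" "j \<noteq> p" for j
    proof (rule ccontr)
      assume none: "\<not> ?thesis"
      have "a \<notin> V j"
        using disjD[of a p j] a p j by blast
      then obtain y where y: "y \<in> V j" "r (insert y (V p - {a})) = n" "r (insert a (V j - {y})) = n"
        using symmetric_exchange[of "V p" n "V j" a] V p j a le_n by blast
      have "y \<notin> V p"
        using disjD[of y p j] y p j by blast
      define V' where "V' = V(p := insert y (V p - {a}), j := insert a (V j - {y}))"
      have V'p: "V' p = insert y (V p - {a})" and V'j: "V' j = insert a (V j - {y})"
        and V'i: "\<And>i. i \<noteq> p \<Longrightarrow> i \<noteq> j \<Longrightarrow> V' i = V i"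
        using j by (auto simp: V'_def)
      have n_pos: "card (V p) = Suc (card (V p - {a}))" "card (V j) = Suc (card (V j - {y}))"
        using V p j a y by (metis card_Suc_Diff1)+
      have "P V'"
        unfolding P_def
      proof (intro conjI allI impI)
        fix i assume "i < t"
        have "finite (V' p)" "card (V' p) = n" "finite (V' j)" "card (V' j) = n"
          using V(1)[OF p] V(1)[OF j(1)] V(2)[OF p] V(2)[OF j(1)] n_pos \<open>a \<notin> V j\<close> \<open>y \<notin> V p\<close>
          by (simp_all add: V'p V'j)
        moreover have "r (V' p) = n" "r (V' j) = n"
          using y by (simp_all add: V'p V'j)
        ultimately show "finite (V' i)" "card (V' i) = n" "r (V' i) = n"
          using V[OF \<open>i < t\<close>] V'i[of i] by metis+
      next
        have owner: "e = y \<and> i = p \<or> e = a \<and> i = j \<or> e \<noteq> y \<and> e \<noteq> a \<and> e \<in> V i"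
          if "e \<in> V' i" "i < t" for e i
        proof -
          consider "i = p" | "i = j" | "i \<noteq> p" "i \<noteq> j"
            by blast
          then show ?thesis
          proof cases
            case 1
            then show ?thesis
              using that(1) \<open>y \<notin> V p\<close> V'p by auto
          next
            case 2
            then show ?thesis
              using that(1) \<open>a \<notin> V j\<close> V'j by auto
          next
            case 3
            then have "e \<in> V i"
              using that(1) V'i by simp
            then show ?thesis
              using disjD[of e p i] disjD[of e j i] 3 a(1) y(1) p j(1) that(2) by blast
          qed
        qed
        show "disjoint_family_on V' {..<t}"
          unfolding disjoint_family_on_def
        proof (intro ballI impI equals0I)
          fix i k e assume "i \<in> {..<t}" "k \<in> {..<t}" "i \<noteq> k" "e \<in> V' i \<inter> V' k"
          then show False
            using owner[of e i] owner[of e k] disjD[of e i k] a(1) \<open>y \<notin> V p\<close> by auto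
        qed
      next
        have "(\<Union>i<t. W i) = W p \<union> W j \<union> (\<Union>i\<in>{..<t} - {p, j}. W i)" for W :: "nat \<Rightarrow> 'e set"
          using p j by auto
        moreover have "V' p \<union> V' j = V p \<union> V j"
          using a y by (auto simp: V'p V'j)
        moreover have "(\<Union>i\<in>{..<t} - {p, j}. V' i) = (\<Union>i\<in>{..<t} - {p, j}. V i)"
          using V'i by auto
        ultimately show "(\<Union>i<t. V' i) = S"
          using V_Un by metis
      qed
      \<comment> \<open>\<open>V' p\<close> keeps the colour of \<open>a\<close> through
        \<open>a'\<close> and gains that of \<open>y\<close>. \<open>V' j\<close> may lose the
        colour of \<open>y\<close> but gains that of \<open>a\<close>, which is new there by
        \<open>none\<close>. So the weight strictly increases.\<close>
      have "c ` V' p = insert (c y) (c ` V p)"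
        using a unfolding V'p by auto
      then have "card (c ` V' p) = Suc (card (c ` V p))"
        using none y V p by auto
      moreover have "card (c ` V j) \<le> card (c ` V' j)"
      proof -
        have "c ` V j = insert (c y) (c ` (V j - {y}))"
          using y by auto
        then have "card (c ` V j) \<le> Suc (card (c ` (V j - {y})))"
          using V j card_insert_le_m1 by (metis card_insert_if finite_Diff finite_imageI le_SucI order_refl)
        moreover have "c a \<notin> c ` (V j - {y})"
          using none a by fastforce
        then have "card (c ` V' j) = Suc (card (c ` (V j - {y})))"
          using V j by (simp add: V'j)
        ultimately show ?thesis
          by simp
      qed
      moreover have "w W = card (c ` W p) + card (c ` W j) + (\<Sum>i\<in>{..<t} - {p, j}. card (c ` W i))" for W
      proof -
        have "{..<t} = insert p (insert j ({..<t} - {p, j}))"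
          using p j by auto
        then have "w W = (\<Sum>i\<in>insert p (insert j ({..<t} - {p, j})). card (c ` W i))"
          by (simp add: w_def)
        then show ?thesis
          using j by simp
      qed
      moreover have "(\<Sum>i\<in>{..<t} - {p, j}. card (c ` V' i)) = (\<Sum>i\<in>{..<t} - {p, j}. card (c ` V i))"
        using V'i by (intro sum.cong) auto
      ultimately have "w V < w V'"
        by simp
      then show False
        using V_max[OF \<open>P V'\<close>] by simp
    qed
    then obtain y where y: "\<And>j. j < t \<Longrightarrow> j \<noteq> p \<Longrightarrow> y j \<in> V j \<and> c (y j) \<in> c ` V p"
      by metis
    \<comment> \<open>One element from each base, with \<open>a\<close> for \<open>V p\<close>
      itself. Deleting all of them loses no colour: each colour occurs in \<open>V p\<close>, and
      there \<open>a'\<close> still represents the colour of \<open>a\<close>.\<close>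
    define z where "z = y(p := a)"
    have z: "z j \<in> V j" if "j < t" for j
      using that y a by (auto simp: z_def)
    have "inj_on z {..<t}"
      by (rule inj_onI) (metis disjD lessThan_iff z)
    then have "card (z ` {..<t}) = t"
      by (simp add: card_image)
    have "finite S"
      using V V_Un by blast
    have zS: "z ` {..<t} \<subseteq> S"
      using z V_Un by blast
    have "c ` S \<subseteq> c ` (S - z ` {..<t})"
    proof -
      have keep: "c ` V p \<subseteq> c ` (S - z ` {..<t})"
      proof -
        have "e \<in> S - z ` {..<t}" if "e \<in> V p" "e \<noteq> a" for e
        proof -
          have "e \<noteq> z j" if "j < t" for j
            using disjD[of e p j] z[OF that] \<open>e \<in> V p\<close> \<open>e \<noteq> a\<close> p that
            by (metis fun_upd_same z_def)
          then show ?thesis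
            using V_Un p \<open>e \<in> V p\<close> by blast
        qed
        then show ?thesis
          using a by (metis (no_types, lifting) image_eqI image_subsetI)
      qed
      moreover have "c (z j) \<in> c ` V p" if "j < t" for j
        using that y a by (auto simp: z_def)
      ultimately show ?thesis
        by blast
    qed
    then have "card (c ` S) \<le> card (S - z ` {..<t})"
      using \<open>finite S\<close> by (meson card_image_le card_mono finite_Diff finite_imageI order_trans)
    also have "\<dots> = card S - t"
      using zS \<open>card (z ` {..<t}) = t\<close> by (simp add: card_Diff_subset)
    also have "card S = t * n"
    proof -
      have "card S = (\<Sum>i<t. card (V i))"
        unfolding V_Un[symmetric] using V V_disj by (intro card_UN_disjoint') auto
      then show ?thesis
        using V by simp
    qed
    finally have "card (c ` S) \<le> t * n - t" .
    \<comment> \<open>Ensures that the subtraction \<open>t * n - t\<close> is not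
      truncated.\<close>
    moreover have "t \<le> t * n"
      using zS \<open>card S = t * n\<close> \<open>card (z ` {..<t}) = t\<close> \<open>finite S\<close> by (metis card_mono)
    ultimately show False
      using colours unfolding S_def[symmetric] by linarith
  qed
  then show ?thesis
    using V V_disj V_Un by (intro exI[of _ V]) (auto simp: S_def)
qed

text \<open>\<open>pack\<close> is the condition for \<open>t\<close> disjoint bases. The slack
  \<open>t\<close> in \<open>colours\<close> yields a union of bases with fewer than
  \<open>t\<close> repeated colours, which is what the exchange argument tolerates; hence the target
  of \<open>t * n + 1 - t\<close> colours.\<close>

theorem disjoint_rainbow_bases:
  fixes c :: "'e \<Rightarrow> 'c"
  assumes "finite E"
    and le_n: "\<And>A. r A \<le> n"
    and pack: "\<And>F. F \<subseteq> E \<Longrightarrow> t * n \<le> t * r F + card (E - F)"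
    and colours: "\<And>F. F \<subseteq> E \<Longrightarrow> t * n < t * r F + card (c ` (E - F)) + t"
    and "t \<ge> 1"
  shows "\<exists>V. (\<forall>i<t. V i \<subseteq> E \<and> card (V i) = n \<and> r (V i) = n \<and> inj_on c (V i)) \<and>
    disjoint_family_on V {..<t}"
proof -
  have "t * n + 1 - t \<le> t * r F + card (c ` (E - F))" if "F \<subseteq> E" for F
    using colours[OF that] by linarith
  then obtain J where J: "\<And>i. i < t \<Longrightarrow> J i \<subseteq> E" "\<And>i. i < t \<Longrightarrow> r (J i) = card (J i)"
    "t * n + 1 - t \<le> card (c ` (\<Union>i<t. J i))"
    using disjoint_independent_many_colours[OF \<open>finite E\<close> _ \<open>t \<ge> 1\<close>] by metis
  obtain U where U: "\<And>i. i < t \<Longrightarrow> U i \<subseteq> E \<and> card (U i) = n \<and> r (U i) = n"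
    "disjoint_family_on U {..<t}" "(\<Union>i<t. J i) \<subseteq> (\<Union>i<t. U i)"
    using extend_to_disjoint_bases[of E n t J, OF \<open>finite E\<close> le_n pack J(1,2) \<open>t \<ge> 1\<close>] by auto
  have fin: "finite (U i)" if "i < t" for i
    using U(1)[OF that] \<open>finite E\<close> finite_subset by blast
  have "card (c ` (\<Union>i<t. J i)) \<le> card (c ` (\<Union>i<t. U i))"
    using fin by (intro card_mono image_mono U(3)) auto
  then have "t * n < card (c ` (\<Union>i<t. U i)) + t"
    using J(3) by linarith
  then have "\<exists>V. (\<forall>i<t. card (V i) = n \<and> r (V i) = n \<and> inj_on c (V i)) \<and>
    disjoint_family_on V {..<t} \<and> (\<Union>i<t. V i) = (\<Union>i<t. U i)"
    using U(1,2) fin le_n by (intro rainbow_bases_of_few_repetitions) auto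
  then obtain V where "\<forall>i<t. card (V i) = n \<and> r (V i) = n \<and> inj_on c (V i)"
    "disjoint_family_on V {..<t}" "(\<Union>i<t. V i) = (\<Union>i<t. U i)"
    by blast
  moreover from this have "V i \<subseteq> E" if "i < t" for i
    using U(1) that by blast
  ultimately show ?thesis
    by blast
qed

end

section \<open>The signed-graphic matroid\<close>

text \<open>The kernel of the transposed signed incidence matrix.\<close>
definition sign_compatible :: "('v, 'e) sgraph \<Rightarrow> 'e set \<Rightarrow> ('v \<Rightarrow> 'a::comm_ring_1) \<Rightarrow> bool" where
  "sign_compatible G F x \<longleftrightarrow>
     (\<forall>e\<in>F. \<forall>u v. ends G e = {u, v} \<longrightarrow> x u = of_int (edge_sign G e) * x v)"

lemma sign_compatible_mono: "sign_compatible G B x \<Longrightarrow> A \<subseteq> B \<Longrightarrow> sign_compatible G A x"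
  by (auto simp: sign_compatible_def)

lemma sign_compatibleD:
  "sign_compatible G F x \<Longrightarrow> e \<in> F \<Longrightarrow> ends G e = {u, v} \<Longrightarrow> x u = of_int (edge_sign G e) * x v"
  by (simp add: sign_compatible_def)

section \<open>Paths, cycles and fibre counting\<close>

lemma sym_adjacency: "sym (adjacency G F)"
  by (auto simp: sym_def adjacency_def insert_commute)

lemma adjacency_mono: "A \<subseteq> B \<Longrightarrow> adjacency G A \<subseteq> adjacency G B"
  by (auto simp: adjacency_def)

lemma adjacency_rtrancl_sym: "(u, v) \<in> (adjacency G F)\<^sup>* \<Longrightarrow> (v, u) \<in> (adjacency G F)\<^sup>*"
  using sym_rtrancl[OF sym_adjacency] by (rule symD)

lemma sign_compatible_zero_rtrancl:
  assumes "sign_compatible G F x" "(u, v) \<in> (adjacency G F)\<^sup>*" "x u = 0"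
  shows "x v = 0"
  using assms(2,3)
proof (induction rule: rtrancl_induct)
  case (step y z)
  then obtain e where "e \<in> F" "ends G e = {z, y}"
    by (auto simp: adjacency_def insert_commute)
  then show ?case
    using sign_compatibleD[OF assms(1)] step by fastforce
qed

lemma exists_simple_path:
  assumes "(u, v) \<in> (adjacency G F)\<^sup>*"
  shows "\<exists>vs es. length vs = Suc (length es) \<and> distinct vs \<and> vs ! 0 = u \<and> vs ! length es = v \<and>
    set es \<subseteq> F \<and> (\<forall>i<length es. ends G (es ! i) = {vs ! i, vs ! Suc i})"
  using assms
proof (induction rule: rtrancl_induct)
  case base
  show ?case
    by (intro exI[of _ "[u]"] exI[of _ "[]"]) auto
next
  case (step y z)
  then obtain vs es where p: "length vs = Suc (length es)" "distinct vs" "vs ! 0 = u"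
    "vs ! length es = y" "set es \<subseteq> F" "\<And>i. i < length es \<Longrightarrow> ends G (es ! i) = {vs ! i, vs ! Suc i}"
    by blast
  show ?case
  proof (cases "z \<in> set vs")
    case True
    then obtain k where k: "k < length vs" "vs ! k = z"
      by (auto simp: in_set_conv_nth)
    show ?thesis
      using p k set_take_subset[of k es]
      by (intro exI[of _ "take (Suc k) vs"] exI[of _ "take k es"]) auto
  next
    case False
    obtain e where e: "e \<in> F" "ends G e = {y, z}"
      using step.hyps by (auto simp: adjacency_def)
    show ?thesis
    proof (intro exI conjI)
      show "\<forall>i<length (es @ [e]). ends G ((es @ [e]) ! i) = {(vs @ [z]) ! i, (vs @ [z]) ! Suc i}"
        using p e by (auto simp: nth_append less_Suc_eq)
    qed (use p e False in \<open>auto simp: nth_append\<close>)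
  qed
qed

text \<open>Rotating the cycle so that \<open>e\<close> comes last removes the wrap-around: the
  remaining edges form a path with plain successor indices.\<close>

lemma cycle_list_ending_with:
  assumes "is_cycle G C" "e \<in> C"
  shows "\<exists>vs es. length vs = Suc (length es) \<and> distinct (es @ [e]) \<and> insert e (set es) = C \<and>
    (\<forall>i<length es. ends G (es ! i) = {vs ! i, vs ! Suc i}) \<and> ends G e = {vs ! length es, vs ! 0}"
proof -
  obtain vs es where c: "es \<noteq> []" "length vs = length es" "distinct es" "set es = C"
    "\<And>i. i < length es \<Longrightarrow> ends G (es ! i) = {vs ! i, vs ! (Suc i mod length es)}"
    using assms(1) unfolding is_cycle_def by blast
  obtain j where j: "j < length es" "es ! j = e"
    using assms(2) c(4) by (auto simp: in_set_conv_nth)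
  define es' vs' where "es' = rotate (Suc j) es" and "vs' = rotate (Suc j) vs"
  let ?k = "length es"
  have len: "length es' = ?k" "length vs' = ?k" "?k > 0"
    using c by (auto simp: es'_def vs'_def)
  have edge: "ends G (es' ! i) = {vs' ! i, vs' ! (Suc i mod ?k)}" if "i < ?k" for i
  proof -
    have "es' ! i = es ! ((Suc j + i) mod ?k)" "vs' ! i = vs ! ((Suc j + i) mod ?k)"
      using that c unfolding es'_def vs'_def by (simp_all only: nth_rotate)
    moreover have "vs' ! (Suc i mod ?k) = vs ! ((Suc j + Suc i mod ?k) mod ?k)"
      using len c unfolding vs'_def by (subst nth_rotate) auto
    moreover have "(Suc j + Suc i mod ?k) mod ?k = Suc ((Suc j + i) mod ?k) mod ?k"
      by (simp add: mod_Suc_eq mod_add_right_eq[of "Suc j" "Suc i", simplified])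
    ultimately show ?thesis
      using c(5)[of "(Suc j + i) mod ?k"] len by simp
  qed
  have "es' ! (?k - 1) = es ! ((Suc j + (?k - 1)) mod ?k)"
    using len unfolding es'_def by (subst nth_rotate) auto
  also have "Suc j + (?k - 1) = j + ?k"
    using len by simp
  finally have "es' ! (?k - 1) = e"
    using j by simp
  then have last: "es' = butlast es' @ [e]"
    using len by (metis append_butlast_last_id last_conv_nth length_greater_0_conv)
  have "distinct es'" "set es' = C"
    using c by (auto simp: es'_def)
  have nth: "butlast es' ! i = es' ! i" if "i < ?k - 1" for i
    using that len by (simp add: nth_butlast)
  show ?thesis
  proof (intro exI[of _ vs'] exI[of _ "butlast es'"] conjI allI impI)
    show "length vs' = Suc (length (butlast es'))"
      using len by simp
    show "distinct (butlast es' @ [e])"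
      using \<open>distinct es'\<close> last by simp
    show "insert e (set (butlast es')) = C"
      using \<open>set es' = C\<close> arg_cong[OF last, of set] by simp
    show "ends G (butlast es' ! i) = {vs' ! i, vs' ! Suc i}" if "i < length (butlast es')" for i
      using that edge[of i] nth[of i] len by simp
    show "ends G e = {vs' ! length (butlast es'), vs' ! 0}"
      using edge[of "?k - 1"] len \<open>es' ! (?k - 1) = e\<close> by simp
  qed
qed

text \<open>A counting substitute for rank-nullity: the nonempty fibres of an additive map inject
  into its kernel by subtracting a fixed element, so \<open>k\<close> will be the size of the
  kernel.\<close>

lemma card_le_fibre_bound:
  assumes "finite X" "finite Y" "h ` X \<subseteq> Y" "\<And>y. y \<in> Y \<Longrightarrow> card {x \<in> X. h x = y} \<le> k"
  shows "card X \<le> card Y * k"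
proof -
  have "X = (\<Union>y\<in>Y. {x \<in> X. h x = y})"
    using assms(3) by auto
  then have "card X \<le> (\<Sum>y\<in>Y. card {x \<in> X. h x = y})"
    using card_UN_le[OF assms(2), of "\<lambda>y. {x \<in> X. h x = y}"] by simp
  also have "\<dots> \<le> card Y * k"
    using sum_bounded_above[of Y "\<lambda>y. card {x \<in> X. h x = y}" k] assms(4) by simp
  finally show ?thesis .
qed

section \<open>Balance and switching\<close>

locale finite_signed_graph =
  fixes G :: "('v, 'e) sgraph"
  assumes signed_graph: "signed_graph G"
begin

lemma finite_vertices: "finite (vertices G)" and finite_edges: "finite (edges G)"
  using signed_graph by (auto simp: signed_graph_def)

lemma ends_subset: "e \<in> edges G \<Longrightarrow> ends G e \<subseteq> vertices G"
  using signed_graph by (fastforce simp: signed_graph_def)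

lemma obtain_ends:
  assumes "e \<in> edges G"
  obtains u v where "u \<in> vertices G" "v \<in> vertices G" "ends G e = {u, v}"
  using signed_graph assms by (auto simp: signed_graph_def)

lemma edge_sign_cases: "e \<in> edges G \<Longrightarrow> edge_sign G e = 1 \<or> edge_sign G e = - 1"
  using signed_graph by (auto simp: signed_graph_def)

lemma edge_sign_square: "e \<in> edges G \<Longrightarrow> edge_sign G e * edge_sign G e = 1"
  using edge_sign_cases by fastforce

lemma cycle_sign_cases:
  assumes "C \<subseteq> edges G"
  shows "cycle_sign G C = 1 \<or> cycle_sign G C = - 1"
proof -
  have "finite C"
    using assms finite_edges finite_subset by blast
  then show ?thesis
    unfolding cycle_sign_def using assms
  proof (induction C rule: finite_induct)
    case (insert e C)
    then show ?case
      using edge_sign_cases[of e] by auto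
  qed simp
qed

text \<open>Chaining the edge equations along \<open>C - {e}\<close> carries \<open>x\<close> from
  one end of \<open>e\<close> to the other. For a positive cycle the result is the equation of
  \<open>e\<close> itself, for a negative cycle its negation.\<close>

lemma cycle_imp_closing_edge:
  fixes x :: "'v \<Rightarrow> 'a::comm_ring_1"
  assumes "is_cycle G C" "e \<in> C" "ends G e = {u, v}"
  shows "(u, v) \<in> (adjacency G (C - {e}))\<^sup>*"
    and "sign_compatible G (C - {e}) x \<Longrightarrow> x u = of_int (cycle_sign G C * edge_sign G e) * x v"
proof -
  have CE: "C \<subseteq> edges G"
    using assms(1) by (simp add: is_cycle_def)
  obtain vs es where c: "distinct (es @ [e])" "insert e (set es) = C"
    "\<And>i. i < length es \<Longrightarrow> ends G (es ! i) = {vs ! i, vs ! Suc i}" "ends G e = {vs ! length es, vs ! 0}"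
    using cycle_list_ending_with[OF assms(1,2)] by blast
  let ?A = "(adjacency G (C - {e}))\<^sup>*" and ?s = "cycle_sign G C * edge_sign G e"
  have es: "es ! i \<in> C - {e}" if "i < length es" for i
    using that c(1,2) nth_mem by force
  have "(vs ! 0, vs ! j) \<in> ?A" if "j \<le> length es" for j
    using that
  proof (induction j)
    case (Suc j)
    then have "(vs ! j, vs ! Suc j) \<in> adjacency G (C - {e})"
      using c(3)[of j] es[of j] by (auto simp: adjacency_def)
    then show ?case
      using Suc by (meson Suc_leD rtrancl.rtrancl_into_rtrancl)
  qed simp
  then have A: "(vs ! 0, vs ! length es) \<in> ?A"
    by simp
  then show "(u, v) \<in> ?A"
    using c(4) assms(3) adjacency_rtrancl_sym[OF A] by (auto simp: doubleton_eq_iff)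
  assume x: "sign_compatible G (C - {e}) x"
  have "x (vs ! 0) = of_int (\<Prod>l<j. edge_sign G (es ! l)) * x (vs ! j)" if "j \<le> length es" for j
    using that
  proof (induction j)
    case (Suc j)
    then have "x (vs ! j) = of_int (edge_sign G (es ! j)) * x (vs ! Suc j)"
      using c(3)[of j] es[of j] by (intro sign_compatibleD[OF x]) auto
    then show ?case
      using Suc by (simp add: mult.assoc)
  qed simp
  moreover have "(\<Prod>l<length es. edge_sign G (es ! l)) = ?s"
  proof -
    have "(\<Prod>l<length es. edge_sign G (es ! l)) = (\<Prod>f\<in>set es. edge_sign G f)"
      using c(1) by (intro prod.reindex_bij_betw bij_betw_nth) auto
    moreover have "cycle_sign G C = edge_sign G e * (\<Prod>f\<in>set es. edge_sign G f)"
      using c(1,2) by (auto simp: cycle_sign_def)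
    ultimately show ?thesis
      using edge_sign_square[of e] CE assms(2) by (simp add: subset_iff mult.commute mult.left_commute)
  qed
  ultimately have fwd: "x (vs ! 0) = of_int ?s * x (vs ! length es)"
    by (metis order_refl)
  \<comment> \<open>A factor of \<open>1\<close> or \<open>- 1\<close> makes the relation symmetric,
    so either order of the ends of \<open>e\<close> is covered.\<close>
  moreover have "?s = 1 \<or> ?s = - 1"
    using cycle_sign_cases[OF CE] edge_sign_cases[of e] CE assms(2) by auto
  then have "x (vs ! length es) = of_int ?s * x (vs ! 0)"
    using fwd by (elim disjE) simp_all
  ultimately show "x u = of_int ?s * x v"
    using c(4) assms(3) by (auto simp: doubleton_eq_iff)
qed

text \<open>A simple path joining the ends of \<open>e\<close> is closed up by \<open>e\<close>. The
  path is empty when \<open>e\<close> is a loop, and a single parallel edge gives a cycle of length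
  two.\<close>

lemma exists_cycle_through_edge:
  assumes F: "insert e F \<subseteq> edges G" "e \<notin> F"
    and uv: "ends G e = {u, v}" "(u, v) \<in> (adjacency G F)\<^sup>*"
  shows "\<exists>C. is_cycle G C \<and> e \<in> C \<and> C \<subseteq> insert e F"
proof -
  obtain vs es where p: "length vs = Suc (length es)" "distinct vs" "vs ! 0 = u"
    "vs ! length es = v" "set es \<subseteq> F" "\<And>i. i < length es \<Longrightarrow> ends G (es ! i) = {vs ! i, vs ! Suc i}"
    using exists_simple_path[OF uv(2)] by blast
  have inj: "i = j" if "i < length es" "j < length es" "es ! i = es ! j" for i j
  proof -
    have "{vs ! i, vs ! Suc i} = {vs ! j, vs ! Suc j}"
      using that p(6) by metis
    then show ?thesis
      using that p(1,2) by (auto simp: doubleton_eq_iff nth_eq_iff_index_eq)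
  qed
  have "vs ! i \<in> vertices G" if "i < length vs" for i
  proof (cases "i < length es")
    case True
    then have "es ! i \<in> edges G"
      using p(5) F(1) nth_mem by blast
    then show ?thesis
      using p(6)[OF True] ends_subset by blast
  next
    case False
    then have "i = length es"
      using that p(1) by simp
    then show ?thesis
      using p(4) uv(1) ends_subset[of e] F(1) by auto
  qed
  then have "set vs \<subseteq> vertices G"
    by (auto simp: in_set_conv_nth)
  have "is_cycle G (insert e (set es))"
    unfolding is_cycle_def
  proof (intro conjI exI[of _ vs] exI[of _ "es @ [e]"] allI impI)
    show "insert e (set es) \<subseteq> edges G"
      using F p(5) by blast
    show "distinct (es @ [e])"
    proof -
      have "distinct es"
        using inj by (auto simp: distinct_conv_nth)
      then show ?thesis
        using F(2) p(5) by auto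
    qed
    show "set vs \<subseteq> vertices G"
      by fact
    show "ends G ((es @ [e]) ! i) = {vs ! i, vs ! (Suc i mod length (es @ [e]))}"
      if "i < length (es @ [e])" for i
    proof (cases "i < length es")
      case True
      then show ?thesis
        using p(6)[OF True] by (simp add: nth_append)
    next
      case False
      then show ?thesis
        using that p(3,4) uv(1) by (simp add: nth_append less_Suc_eq insert_commute)
    qed
  qed (use p in auto)
  then show ?thesis
    using p(5) by blast
qed

text \<open>Harary's switching theorem, by adding edges one at a time. An edge within a component
  closes a positive cycle and is compatible already; an edge between two components is made
  compatible by switching one of them.\<close>

lemma balanced_imp_switching:
  assumes "F \<subseteq> edges G" "balanced G F"
  shows "\<exists>p :: 'v \<Rightarrow> 'a::comm_ring_1. (\<forall>v. p v = 1 \<or> p v = - 1) \<and> sign_compatible G F p"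
proof -
  have "finite F"
    using assms(1) finite_edges finite_subset by blast
  then show ?thesis
    using assms
  proof (induction F rule: finite_induct)
    case empty
    show ?case
      by (intro exI[of _ "\<lambda>_. 1"]) (simp add: sign_compatible_def)
  next
    case (insert e F)
    have "balanced G F"
      using insert.prems(2) by (auto simp: balanced_def)
    then obtain p :: "'v \<Rightarrow> 'a" where p: "\<And>v. p v = 1 \<or> p v = - 1" "sign_compatible G F p"
      using insert.IH insert.prems(1) by blast
    have e: "e \<in> edges G"
      using insert.prems by simp
    obtain u v where uv: "ends G e = {u, v}"
      using obtain_ends[OF e] by blast
    let ?\<sigma> = "of_int (edge_sign G e) :: 'a"
    have \<sigma>: "?\<sigma> = 1 \<or> ?\<sigma> = - 1"
      using edge_sign_cases[OF e] by auto
    show ?case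
    proof (cases "(u, v) \<in> (adjacency G F)\<^sup>*")
      case True
      then obtain C where C: "is_cycle G C" "e \<in> C" "C \<subseteq> insert e F"
        using exists_cycle_through_edge[of e F u v] insert uv by blast
      then have "cycle_sign G C = 1"
        using insert.prems(2) by (auto simp: balanced_def positive_cycle_def)
      moreover have "sign_compatible G (C - {e}) p"
        by (rule sign_compatible_mono[OF p(2)]) (use C in blast)
      ultimately have "p u' = ?\<sigma> * p v'" if "ends G e = {u', v'}" for u' v'
        using cycle_imp_closing_edge(2)[OF C(1,2) that, of p] by simp
      then have "sign_compatible G (insert e F) p"
        using p(2) by (simp add: sign_compatible_def)
      then show ?thesis
        using p(1) by blast
    next
      case False
      \<comment> \<open>Chosen so that \<open>s * p u = ?\<sigma> * p v\<close>, using that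
        \<open>p u\<close> squares to one.\<close>
      define s where "s = ?\<sigma> * p u * p v"
      define q where "q w = (if (u, w) \<in> (adjacency G F)\<^sup>* then s * p w else p w)" for w
      have s: "s = 1 \<or> s = - 1"
        using \<sigma> p(1)[of u] p(1)[of v] by (auto simp: s_def)
      have "q w = 1 \<or> q w = - 1" for w
        using s p(1)[of w] by (auto simp: q_def)
      moreover have "q u' = of_int (edge_sign G f) * q v'"
        if f: "f \<in> insert e F" "ends G f = {u', v'}" for f u' v'
      proof (cases "f = e")
        case True
        have "q u = ?\<sigma> * q v" "q v = ?\<sigma> * q u"
          using False \<sigma> p(1)[of u] p(1)[of v] by (auto simp: q_def s_def)
        then show ?thesis
          using True f uv by (auto simp: doubleton_eq_iff)
      next
        case False
        then have "f \<in> F"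
          using f by blast
        then have "(u', v') \<in> adjacency G F" "(v', u') \<in> adjacency G F"
          using f by (auto simp: adjacency_def insert_commute)
        then have "(u, u') \<in> (adjacency G F)\<^sup>* \<longleftrightarrow> (u, v') \<in> (adjacency G F)\<^sup>*"
          by (meson rtrancl.rtrancl_into_rtrancl)
        then show ?thesis
          using sign_compatibleD[OF p(2) \<open>f \<in> F\<close> f(2)] by (simp add: q_def)
      qed
      then have "sign_compatible G (insert e F) q"
        unfolding sign_compatible_def by blast
      ultimately show ?thesis
        by blast
    qed
  qed
qed


section \<open>Components and labellings over the field with three elements\<close>

lemma equiv_reachability: "equiv (vertices G) (reachability G F)"
proof (rule equivI)
  show "sym (reachability G F)"
    by (auto simp: sym_def reachability_def intro: adjacency_rtrancl_sym)
  show "trans (reachability G F)"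
    by (auto simp: trans_def reachability_def intro: rtrancl_trans)
qed (auto simp: reachability_def refl_on_def)

lemma component_connected:
  "W \<in> graph_components G F \<Longrightarrow> u \<in> W \<Longrightarrow> v \<in> W \<Longrightarrow> (u, v) \<in> (adjacency G F)\<^sup>*"
  using quotient_eq_iff[OF equiv_reachability, of W F W u v]
  by (simp add: graph_components_def reachability_def)

lemma component_subset: "W \<in> graph_components G F \<Longrightarrow> W \<subseteq> vertices G"
  using in_quotient_imp_subset[OF equiv_reachability] by (simp add: graph_components_def)

lemma component_of_vertex:
  "v \<in> vertices G \<Longrightarrow> reachability G F `` {v} \<in> graph_components G F"
  by (simp add: graph_components_def quotientI)

lemma component_eq:
  "W \<in> graph_components G F \<Longrightarrow> v \<in> W \<Longrightarrow> reachability G F `` {v} = W"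
  using Image_singleton_iff equiv_class_eq[OF equiv_reachability] 
  by (auto simp: graph_components_def elim!: quotientE)

lemma vertex_in_component: "v \<in> vertices G \<Longrightarrow> v \<in> reachability G F `` {v}"
  by (simp add: reachability_def)

lemma finite_components: "finite (graph_components G F)"
  unfolding graph_components_def
  by (rule finite_quotient[OF finite_vertices]) (auto simp: reachability_def)

lemma reachability_of_edge:
  assumes "F \<subseteq> edges G" "e \<in> F" "ends G e = {u, v}"
  shows "(u, v) \<in> reachability G F"
proof -
  have "(u, v) \<in> adjacency G F"
    using assms by (auto simp: adjacency_def)
  moreover have "u \<in> vertices G" "v \<in> vertices G"
    using assms ends_subset[of e] by auto
  ultimately show ?thesis
    by (simp add: reachability_def)
qed

lemma unbalanced_imp_negative_cycle:
  assumes "\<not> balanced G F"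
  shows "\<exists>C. negative_cycle G C \<and> C \<subseteq> F"
proof -
  obtain C where "is_cycle G C" "C \<subseteq> F" "\<not> positive_cycle G C"
    using assms by (auto simp: balanced_def)
  moreover from this have "cycle_sign G C = - 1"
    using cycle_sign_cases[of C] by (auto simp: is_cycle_def positive_cycle_def)
  ultimately show ?thesis
    by (auto simp: negative_cycle_def)
qed

lemma is_cycle_nonempty: "is_cycle G C \<Longrightarrow> C \<noteq> {}"
  by (auto simp: is_cycle_def)

text \<open>Going once round the cycle gives \<open>x u = - x u\<close>, and in characteristic three
  this leaves only zero.\<close>

lemma sign_compatible_negative_cycle:
  fixes x :: "'v \<Rightarrow> 3"
  assumes "negative_cycle G C" "sign_compatible G C x" "e \<in> C" "ends G e = {u, v}"
  shows "x u = 0"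
proof -
  have "x u = of_int (cycle_sign G C * edge_sign G e) * x v"
    using assms cycle_imp_closing_edge(2)[of C e u v x] sign_compatible_mono[OF assms(2), of "C - {e}"]
    by (auto simp: negative_cycle_def)
  also have "\<dots> = - (of_int (edge_sign G e) * x v)"
    using assms(1) by (simp add: negative_cycle_def)
  also have "\<dots> = - x u"
    using sign_compatibleD[OF assms(2-4)] by simp
  finally have "x u + x u = 0"
    by (metis add.right_inverse)
  moreover have "(x u + x u) + x u = (1 + 1 + 1) * x u"
    by (simp only: distrib_right mult_1)
  moreover have "(1 + 1 + 1 :: 3) = 0"
    by simp
  ultimately show ?thesis
    by (metis add_0 mult_zero_left)
qed

lemma sign_compatible_unbalanced_component:
  fixes x :: "'v \<Rightarrow> 3"
  assumes "F \<subseteq> edges G" "sign_compatible G F x"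
    and W: "W \<in> graph_components G F" "\<not> balanced G (edges_within G F W)" "v \<in> W"
  shows "x v = 0"
proof -
  obtain C where C: "negative_cycle G C" "C \<subseteq> edges_within G F W"
    using unbalanced_imp_negative_cycle[OF W(2)] by blast
  then obtain e where e: "e \<in> C"
    using is_cycle_nonempty by (auto simp: negative_cycle_def)
  then have "e \<in> F" "ends G e \<subseteq> W"
    using C by (auto simp: edges_within_def)
  moreover obtain u u' where u: "ends G e = {u, u'}"
    using obtain_ends[OF subsetD[OF assms(1) \<open>e \<in> F\<close>]] by blast
  moreover have "sign_compatible G C x"
    by (rule sign_compatible_mono[OF assms(2)]) (use C in \<open>auto simp: edges_within_def\<close>)
  ultimately have "x u = 0" "u \<in> W"
    using sign_compatible_negative_cycle[OF C(1) _ e u] by auto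
  then show ?thesis
    using sign_compatible_zero_rtrancl[OF assms(2) component_connected[OF W(1)]] W(3) by blast
qed

text \<open>Labels off \<open>vertices G\<close> are pinned to zero so that the set is finite; its
  size then encodes its dimension as a power of three.\<close>

definition solutions :: "'e set \<Rightarrow> ('v \<Rightarrow> 3) set" where
  "solutions F = {x. (\<forall>v. v \<notin> vertices G \<longrightarrow> x v = 0) \<and> sign_compatible G F x}"

lemma solutions_Un: "solutions (A \<union> B) = solutions A \<inter> solutions B"
  by (auto simp: solutions_def sign_compatible_def)

lemma solutions_antimono: "A \<subseteq> B \<Longrightarrow> solutions B \<subseteq> solutions A"
  by (auto simp: solutions_def sign_compatible_def)

lemma solutions_add: "x \<in> solutions F \<Longrightarrow> y \<in> solutions F \<Longrightarrow> x + y \<in> solutions F"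
  by (auto simp: solutions_def sign_compatible_def distrib_left)

lemma solutions_diff: "x \<in> solutions F \<Longrightarrow> y \<in> solutions F \<Longrightarrow> x - y \<in> solutions F"
  by (auto simp: solutions_def sign_compatible_def right_diff_distrib)

text \<open>
  A solution vanishes on unbalanced components, and on a balanced component it is determined by
  its value at one vertex.
\<close>
lemma card_solutions:
  assumes F: "F \<subseteq> edges G"
  shows "card (solutions F) = 3 ^ num_balanced G F"
proof -
  define BC where "BC = {W \<in> graph_components G F. balanced G (edges_within G F W)}"
  define comp where "comp v = reachability G F `` {v}" for v
  define root where "root W = (SOME w. w \<in> W)" for W :: "'v set"
  have root: "root W \<in> W" if "W \<in> graph_components G F" for W
    using in_quotient_imp_non_empty[OF equiv_reachability, of W F] that
    by (simp add: root_def graph_components_def some_in_eq)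
  have "bij_betw (\<lambda>x. \<lambda>W\<in>BC. x (root W)) (solutions F) (BC \<rightarrow>\<^sub>E (UNIV :: 3 set))"
    unfolding bij_betw_def
  proof (intro conjI inj_onI ext)
    fix x y v
    assume x: "x \<in> solutions F" and y: "y \<in> solutions F"
      and eq: "(\<lambda>W\<in>BC. x (root W)) = (\<lambda>W\<in>BC. y (root W))"
    have d: "x - y \<in> solutions F"
      using x y by (rule solutions_diff)
    show "x v = y v"
    proof (cases "v \<in> vertices G")
      case False
      then show ?thesis
        using x y by (simp add: solutions_def)
    next
      case True
      then have W: "comp v \<in> graph_components G F" "v \<in> comp v"
        using component_of_vertex[OF True, of F] vertex_in_component[OF True, of F]
        unfolding comp_def by auto
      have "(x - y) v = 0"
      proof (cases "comp v \<in> BC")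
        case True
        then have "(x - y) (root (comp v)) = 0"
          using fun_cong[OF eq, of "comp v"] by simp
        then show ?thesis
          using sign_compatible_zero_rtrancl[of G F "x - y"] component_connected[OF W(1) root[OF W(1)] W(2)] d
          by (auto simp: solutions_def)
      next
        case False
        then show ?thesis
          using sign_compatible_unbalanced_component[OF F _ W(1) _ W(2), of "x - y"] d W(1)
          by (auto simp: solutions_def BC_def)
      qed
      then show ?thesis
        by simp
    qed
  next
    show "(\<lambda>x. \<lambda>W\<in>BC. x (root W)) ` solutions F = BC \<rightarrow>\<^sub>E UNIV"
    proof (intro equalityI subsetI)
      fix g :: "'v set \<Rightarrow> 3" assume g: "g \<in> BC \<rightarrow>\<^sub>E UNIV"
      have "\<forall>W\<in>BC. \<exists>p :: 'v \<Rightarrow> 3. (\<forall>v. p v = 1 \<or> p v = - 1) \<and> sign_compatible G (edges_within G F W) p"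
        using F by (intro ballI balanced_imp_switching) (auto simp: BC_def edges_within_def)
      then obtain q :: "'v set \<Rightarrow> 'v \<Rightarrow> 3" where q: "\<And>W v. W \<in> BC \<Longrightarrow> q W v = 1 \<or> q W v = - 1"
        "\<And>W. W \<in> BC \<Longrightarrow> sign_compatible G (edges_within G F W) (q W)"
        by metis
      \<comment> \<open>On each balanced component, a switching function scaled by its own value at
        the root: that value squares to one, so \<open>x\<close> equals \<open>g\<close> at the
        root.\<close>
      define x where "x v = (if v \<in> vertices G \<and> comp v \<in> BC
        then g (comp v) * q (comp v) (root (comp v)) * q (comp v) v else 0)" for v
      have "x u = of_int (edge_sign G e) * x v" if e: "e \<in> F" "ends G e = {u, v}" for e u v
      proof -
        have uv: "(u, v) \<in> reachability G F"
          using reachability_of_edge[OF F e] .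
        then have c: "comp u = comp v"
          unfolding comp_def by (rule equiv_class_eq[OF equiv_reachability])
        have V: "u \<in> vertices G" "v \<in> vertices G"
          using uv by (auto simp: reachability_def)
        show ?thesis
        proof (cases "comp v \<in> BC")
          case True
          have "ends G e \<subseteq> comp v"
            using e(2) vertex_in_component[OF V(1), of F] vertex_in_component[OF V(2), of F] c
            unfolding comp_def by simp
          then have "e \<in> edges_within G F (comp v)"
            using e by (simp add: edges_within_def)
          then have "q (comp v) u = of_int (edge_sign G e) * q (comp v) v"
            using sign_compatibleD[OF q(2)[OF True]] e(2) by blast
          then show ?thesis
            using True V c by (simp add: x_def)
        qed (simp add: x_def c)
      qed
      then have "x \<in> solutions F"
        by (auto simp: solutions_def sign_compatible_def x_def)
      moreover have "x (root W) = g W" if W: "W \<in> BC" for W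
      proof -
        have comps: "W \<in> graph_components G F"
          using W by (simp add: BC_def)
        then have "comp (root W) = W" "root W \<in> vertices G"
          using component_eq[OF comps root] component_subset[OF comps] root
          unfolding comp_def by blast+
        then show ?thesis
          using W q(1)[OF W, of "root W"] by (auto simp: x_def)
      qed
      then have "(\<lambda>W\<in>BC. x (root W)) = g"
        using g by (auto simp: fun_eq_iff restrict_def PiE_def extensional_def)
      ultimately show "g \<in> (\<lambda>x. \<lambda>W\<in>BC. x (root W)) ` solutions F"
        by blast
    qed auto
  qed
  then have "card (solutions F) = card (BC \<rightarrow>\<^sub>E (UNIV :: 3 set))"
    by (rule bij_betw_same_card)
  also have "\<dots> = 3 ^ card BC"
    using finite_components by (subst card_PiE) (auto simp: BC_def)
  finally show ?thesis
    by (simp add: num_balanced_def BC_def)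
qed

lemma finite_solutions: "F \<subseteq> edges G \<Longrightarrow> finite (solutions F)"
  using card_solutions[of F] card_gt_0_iff[of "solutions F"] by simp

lemma num_balanced_antimono:
  assumes "A \<subseteq> B" "B \<subseteq> edges G"
  shows "num_balanced G B \<le> num_balanced G A"
proof -
  have "card (solutions B) \<le> card (solutions A)"
    using assms by (intro card_mono finite_solutions solutions_antimono) auto
  then show ?thesis
    using assms by (simp add: card_solutions)
qed

text \<open>Addition maps \<open>solutions A \<times> solutions B\<close> to \<open>solutions (A \<inter> B)\<close>, with kernel \<open>solutions (A \<union> B)\<close>.\<close>
lemma num_balanced_supermodular:
  assumes "A \<subseteq> edges G" "B \<subseteq> edges G"
  shows "num_balanced G A + num_balanced G B \<le> num_balanced G (A \<union> B) + num_balanced G (A \<inter> B)"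
proof -
  have E: "A \<union> B \<subseteq> edges G" "A \<inter> B \<subseteq> edges G"
    using assms by auto
  have "card (solutions A \<times> solutions B) \<le> card (solutions (A \<inter> B)) * card (solutions (A \<union> B))"
  proof (rule card_le_fibre_bound[where h = "\<lambda>(x, y). x + y"])
    show "(\<lambda>(x, y). x + y) ` (solutions A \<times> solutions B) \<subseteq> solutions (A \<inter> B)"
      using solutions_antimono[of "A \<inter> B" A] solutions_antimono[of "A \<inter> B" B]
      by (auto intro!: solutions_add)
    fix z
    let ?S = "{s \<in> solutions A \<times> solutions B. (case s of (x, y) \<Rightarrow> x + y) = z}"
    show "card ?S \<le> card (solutions (A \<union> B))"
    proof (cases "?S = {}")
      case False
      then obtain x0 y0 where 0: "x0 \<in> solutions A" "y0 \<in> solutions B" "x0 + y0 = z"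
        by auto
      have "inj_on (\<lambda>(x, y). x - x0) ?S"
        by (auto simp: inj_on_def)
      moreover have "(\<lambda>(x, y). x - x0) ` ?S \<subseteq> solutions (A \<union> B)"
      proof clarify
        fix x y assume xy: "x \<in> solutions A" "y \<in> solutions B" "z = x + y"
        \<comment> \<open>The left side is in \<open>solutions A\<close> and the right side in
          \<open>solutions B\<close>, so the difference solves both systems.\<close>
        have "x - x0 = y0 - y"
          using 0 xy by (metis add.commute add_diff_eq diff_add_cancel diff_eq_eq)
        then show "x - x0 \<in> solutions (A \<union> B)"
          using solutions_diff[OF xy(1) 0(1)] solutions_diff[OF 0(2) xy(2)] by (simp add: solutions_Un)
      qed
      ultimately show ?thesis
        using finite_solutions[OF E(1)] by (rule card_inj_on_le)
    qed (simp only: card.empty)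
  qed (use assms E in \<open>auto intro: finite_solutions\<close>)
  then have "(3::nat) ^ (num_balanced G A + num_balanced G B) \<le> 3 ^ (num_balanced G (A \<union> B) + num_balanced G (A \<inter> B))"
    using assms E by (simp add: card_cartesian_product card_solutions power_add mult.commute)
  then show ?thesis
    by simp
qed

text \<open>A new edge adds one linear equation \<open>h x = 0\<close>. Its defect \<open>h\<close>
  takes at most three values, so the number of solutions drops at most by a factor of three.\<close>

lemma num_balanced_insert:
  assumes "insert e F \<subseteq> edges G"
  shows "num_balanced G F \<le> Suc (num_balanced G (insert e F))"
proof -
  have e: "e \<in> edges G"
    using assms by simp
  obtain u v where uv: "ends G e = {u, v}"
    using obtain_ends[OF e] by blast
  define h where "h x = x u - of_int (edge_sign G e) * x v" for x :: "'v \<Rightarrow> 3"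
  have "card (solutions F) \<le> card (UNIV :: 3 set) * card (solutions (insert e F))"
  proof (rule card_le_fibre_bound[where h = h])
    fix a
    show "card {x \<in> solutions F. h x = a} \<le> card (solutions (insert e F))"
    proof (cases "{x \<in> solutions F. h x = a} = {}")
      case False
      then obtain x0 where 0: "x0 \<in> solutions F" "h x0 = a"
        by auto
      have "inj_on (\<lambda>x. x - x0) {x \<in> solutions F. h x = a}"
        by (auto simp: inj_on_def)
      moreover have "(\<lambda>x. x - x0) ` {x \<in> solutions F. h x = a} \<subseteq> solutions (insert e F)"
      proof clarify
        fix x assume x: "x \<in> solutions F" "a = h x"
        define y where "y = x - x0"
        have y: "y \<in> solutions F"
          unfolding y_def using x 0 by (intro solutions_diff)
        have "y u = of_int (edge_sign G e) * y v"
          using x(2) 0(2) by (simp add: h_def y_def algebra_simps)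
        moreover from this have "y v = of_int (edge_sign G e) * y u"
          using edge_sign_cases[of e] assms by auto
        ultimately have "y u' = of_int (edge_sign G e) * y v'" if "ends G e = {u', v'}" for u' v'
          using that uv by (auto simp: doubleton_eq_iff)
        then show "x - x0 \<in> solutions (insert e F)"
          using y unfolding y_def[symmetric] by (simp add: solutions_def sign_compatible_def)
      qed
      ultimately show ?thesis
        using finite_solutions[OF assms] by (rule card_inj_on_le)
    qed (simp only: card.empty)
  qed (use assms in \<open>auto intro: finite_solutions\<close>)
  then have "(3::nat) ^ num_balanced G F \<le> 3 ^ Suc (num_balanced G (insert e F))"
    using assms by (simp add: card_solutions)
  then show ?thesis
    by (metis one_less_numeral_iff power_increasing_iff semiring_norm(77))
qed

lemma num_balanced_empty: "num_balanced G {} = card (vertices G)"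
proof -
  have "adjacency G {} = {}"
    by (simp add: adjacency_def)
  then have "reachability G {} `` {v} = {v}" if "v \<in> vertices G" for v
    using that by (auto simp: reachability_def)
  then have "graph_components G {} = (\<lambda>v. {v}) ` vertices G"
    by (auto simp: graph_components_def quotient_def)
  moreover have "balanced G (edges_within G {} W)" for W
    using is_cycle_nonempty by (auto simp: balanced_def edges_within_def)
  ultimately have "num_balanced G {} = card ((\<lambda>v. {v}) ` vertices G)"
    by (simp add: num_balanced_def)
  then show ?thesis
    by (simp add: card_image)
qed

lemma num_balanced_connected_unbalanced:
  assumes "connected_graph G" "negative_cycle G C"
  shows "num_balanced G (edges G) = 0"
proof -
  have "\<not> balanced G (edges_within G (edges G) W)" if W: "W \<in> graph_components G (edges G)" for W
  proof -
    obtain w where "w \<in> vertices G" "W = reachability G (edges G) `` {w}"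
      using W by (auto simp: graph_components_def elim!: quotientE)
    then have "vertices G \<subseteq> W"
      using assms(1) by (auto simp: connected_graph_def)
    then have "edges_within G (edges G) W = edges G"
      using ends_subset by (auto simp: edges_within_def)
    then show ?thesis
      using assms(2) is_cycle_def[of G C] by (auto simp: balanced_def negative_cycle_def positive_cycle_def)
  qed
  then show ?thesis
    by (auto simp: num_balanced_def card_eq_0_iff)
qed

section \<open>Rank function and bases of the signed-graphic matroid\<close>

text \<open>Intersecting with \<open>edges G\<close> makes the function total, as
  \<open>matroid_rank\<close> requires; objects that are not edges get rank zero.\<close>

definition signed_rank :: "'e set \<Rightarrow> nat" where
  "signed_rank F = card (vertices G) - num_balanced G (F \<inter> edges G)"

lemma num_balanced_le: "F \<subseteq> edges G \<Longrightarrow> num_balanced G F \<le> card (vertices G)"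
  using num_balanced_antimono[of "{}" F] by (simp add: num_balanced_empty)

lemma signed_rank_add_num_balanced:
  "F \<subseteq> edges G \<Longrightarrow> signed_rank F + num_balanced G F = card (vertices G)"
  using num_balanced_le[of F] by (simp add: signed_rank_def Int_absorb2)

sublocale matroid_rank signed_rank
proof
  show "signed_rank {} = 0"
    by (simp add: signed_rank_def num_balanced_empty)
  show "signed_rank {e} \<le> 1" for e
  proof (cases "e \<in> edges G")
    case True
    then show ?thesis
      using num_balanced_insert[of e "{}"] by (simp add: signed_rank_def num_balanced_empty)
  qed (simp add: signed_rank_def num_balanced_empty)
  show "signed_rank A \<le> signed_rank B" if "A \<subseteq> B" for A B
    using num_balanced_antimono[of "A \<inter> edges G" "B \<inter> edges G"] that
    unfolding signed_rank_def by (intro diff_le_mono2) auto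
  show "signed_rank (A \<union> B) + signed_rank (A \<inter> B) \<le> signed_rank A + signed_rank B" for A B
  proof -
    let ?E = "edges G"
    have "(A \<union> B) \<inter> ?E = (A \<inter> ?E) \<union> (B \<inter> ?E)" "(A \<inter> B) \<inter> ?E = (A \<inter> ?E) \<inter> (B \<inter> ?E)"
      by auto
    then have "num_balanced G (A \<inter> ?E) + num_balanced G (B \<inter> ?E)
      \<le> num_balanced G ((A \<union> B) \<inter> ?E) + num_balanced G ((A \<inter> B) \<inter> ?E)"
      using num_balanced_supermodular[of "A \<inter> ?E" "B \<inter> ?E"] by simp
    moreover have "num_balanced G (X \<inter> ?E) \<le> card (vertices G)" for X
      by (rule num_balanced_le) blast
    note this[of A] this[of B] this[of "A \<union> B"] this[of "A \<inter> B"]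
    ultimately show ?thesis
      unfolding signed_rank_def by linarith
  qed
qed

lemma signed_unicyclic_imp_num_balanced:
  assumes "signed_unicyclic G U"
  shows "num_balanced G U = 0"
proof -
  have "\<not> balanced G (edges_within G U W)" if W: "W \<in> graph_components G U" for W
  proof -
    obtain C where C: "is_cycle G C" "C \<subseteq> edges_within G U W" "negative_cycle G C"
      using assms W unfolding signed_unicyclic_def by blast
    then show ?thesis
      by (auto simp: balanced_def positive_cycle_def negative_cycle_def)
  qed
  then show ?thesis
    by (auto simp: num_balanced_def card_eq_0_iff)
qed

text \<open>Deleting an edge \<open>e\<close> from a base creates a labelling that violates only the
  equation of \<open>e\<close>. A positive cycle through \<open>e\<close>, or a second cycle in its
  component avoiding \<open>e\<close>, would force that equation after all.\<close>

lemma basis_imp_signed_unicyclic: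
  assumes U: "U \<subseteq> edges G" "card U = card (vertices G)" "num_balanced G U = 0"
  shows "signed_unicyclic G U"
proof -
  have finU: "finite U"
    using U(1) finite_edges finite_subset by blast
  have critical: "\<exists>(x :: 'v \<Rightarrow> 3) u v. sign_compatible G (U - {e}) x \<and> ends G e = {u, v} \<and>
      x u \<noteq> of_int (edge_sign G e) * x v" if e: "e \<in> U" for e
  proof -
    have "signed_rank (U - {e}) < card (vertices G)"
      using rank_le_card[of "U - {e}"] finU e card_Diff1_less[OF finU e] U(2) by simp
    then have "num_balanced G (U - {e}) \<noteq> 0"
      using signed_rank_add_num_balanced[of "U - {e}"] U(1) by (metis Diff_subset add_0_right nless_le subset_trans)
    then have "solutions (U - {e}) \<noteq> solutions U"
    proof -
      have "U - {e} \<subseteq> edges G"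
        using U(1) by blast
      then have "card (solutions (U - {e})) \<noteq> 1"
        using card_solutions \<open>num_balanced G (U - {e}) \<noteq> 0\<close> by simp
      then show ?thesis
        using card_solutions[OF U(1)] U(3) by force
    qed
    then obtain x where x: "x \<in> solutions (U - {e})" "x \<notin> solutions U"
      using solutions_antimono[of "U - {e}" U] by blast
    then have "\<not> sign_compatible G U x" "sign_compatible G (U - {e}) x"
      by (auto simp: solutions_def)
    then show ?thesis
      unfolding sign_compatible_def by blast
  qed
  have negative: "negative_cycle G C" if C: "is_cycle G C" "C \<subseteq> U" for C
  proof (rule ccontr)
    assume "\<not> negative_cycle G C"
    then have "cycle_sign G C = 1"
      using C U(1) cycle_sign_cases[of C] by (auto simp: negative_cycle_def)
    moreover obtain e where e: "e \<in> C"
      using is_cycle_nonempty[OF C(1)] by blast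
    moreover obtain x :: "'v \<Rightarrow> 3" and u v where x: "sign_compatible G (U - {e}) x"
      "ends G e = {u, v}" "x u \<noteq> of_int (edge_sign G e) * x v"
      using critical[of e] e C by blast
    moreover have "sign_compatible G (C - {e}) x"
      by (rule sign_compatible_mono[OF x(1)]) (use C in blast)
    ultimately show False
      using cycle_imp_closing_edge(2)[OF C(1) e x(2), of x] by simp
  qed
  \<comment> \<open>For \<open>e\<close> in \<open>C\<close> but not in \<open>D\<close>, the
    labelling critical for \<open>e\<close> vanishes on the negative cycle \<open>D\<close>. As
    \<open>C - {e}\<close> bypasses \<open>e\<close>, the component stays connected without
    \<open>e\<close>, so the zero spreads to both ends of \<open>e\<close>.\<close>
  have unique: "C \<subseteq> D" if W: "W \<in> graph_components G U"
    and C: "is_cycle G C" "C \<subseteq> edges_within G U W"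
    and D: "is_cycle G D" "D \<subseteq> edges_within G U W" for C D W
  proof (rule ccontr)
    assume "\<not> C \<subseteq> D"
    then obtain e where e: "e \<in> C" "e \<notin> D"
      by blast
    have sub: "C \<subseteq> U" "D \<subseteq> U"
      using C D by (auto simp: edges_within_def)
    obtain x :: "'v \<Rightarrow> 3" and u v where x: "sign_compatible G (U - {e}) x"
      "ends G e = {u, v}" "x u \<noteq> of_int (edge_sign G e) * x v"
      using critical[of e] e sub by blast
    have uvW: "u \<in> W" "v \<in> W"
      using C e x(2) by (auto simp: edges_within_def)
    obtain f where f: "f \<in> D"
      using is_cycle_nonempty[OF D(1)] by blast
    moreover obtain w w' where w: "ends G f = {w, w'}"
      using obtain_ends[of f thesis] f sub U(1) by auto
    moreover have "sign_compatible G D x"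
      by (rule sign_compatible_mono[OF x(1)]) (use sub e in blast)
    ultimately have "x w = 0"
      using sign_compatible_negative_cycle[OF negative[OF D(1) sub(2)]] by blast
    have "w \<in> W"
      using D f w by (auto simp: edges_within_def)
    let ?A = "(adjacency G (U - {e}))\<^sup>*"
    have "(u, v) \<in> ?A"
      using cycle_imp_closing_edge(1)[OF C(1) e(1) x(2)] rtrancl_mono[OF adjacency_mono[of "C - {e}" "U - {e}" G]] sub
      by blast
    then have "(v, u) \<in> ?A"
      by (rule adjacency_rtrancl_sym)
    have "adjacency G U \<subseteq> ?A"
    proof clarify
      fix a b assume "(a, b) \<in> adjacency G U"
      then obtain g where g: "g \<in> U" "ends G g = {a, b}"
        by (auto simp: adjacency_def)
      show "(a, b) \<in> ?A"
      proof (cases "g = e")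
        case True
        then show ?thesis
          using g x(2) \<open>(u, v) \<in> ?A\<close> \<open>(v, u) \<in> ?A\<close> by (auto simp: doubleton_eq_iff)
      next
        case False
        then show ?thesis
          using g by (intro r_into_rtrancl) (auto simp: adjacency_def)
      qed
    qed
    then have "(adjacency G U)\<^sup>* \<subseteq> ?A"
      by (rule rtrancl_subset_rtrancl)
    then have "(w, u) \<in> ?A" "(w, v) \<in> ?A"
      using component_connected[OF W \<open>w \<in> W\<close>] uvW by blast+
    then have "x u = 0" "x v = 0"
      using sign_compatible_zero_rtrancl[OF x(1)] \<open>x w = 0\<close> by blast+
    then show False
      using x(3) by simp
  qed
  show ?thesis
    unfolding signed_unicyclic_def
  proof (intro conjI ballI allI impI)
    fix W assume W: "W \<in> graph_components G U"
    have "\<not> balanced G (edges_within G U W)"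
      using U(3) W finite_components[of U] by (auto simp: num_balanced_def)
    then obtain C where "is_cycle G C" "C \<subseteq> edges_within G U W"
      using unbalanced_imp_negative_cycle by (auto simp: negative_cycle_def)
    then show "\<exists>!C. is_cycle G C \<and> C \<subseteq> edges_within G U W"
      using unique[OF W] by (intro ex1I[of _ C]) (auto intro!: equalityI)
    show "negative_cycle G C" if "is_cycle G C \<and> C \<subseteq> edges_within G U W" for C
      using that negative by (auto simp: edges_within_def)
  qed (use U in blast)
qed

text \<open>\<open>U\<close> has full rank, so the edges of \<open>U\<close> outside
  \<open>F\<close> must make up the whole rank deficit \<open>num_balanced G F\<close> of
  \<open>F\<close>. Both colouring constructions rest on this bound.\<close>

lemma num_balanced_le_card_diff:
  assumes "signed_unicyclic G U" "F \<subseteq> edges G"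
  shows "num_balanced G F \<le> card (U - F)"
proof -
  have "U \<subseteq> edges G"
    using assms(1) by (simp add: signed_unicyclic_def)
  then have "signed_rank U = card (vertices G)"
    using signed_rank_add_num_balanced[of U] signed_unicyclic_imp_num_balanced[OF assms(1)] by simp
  moreover have "signed_rank U \<le> signed_rank (F \<union> (U - F))"
    by (rule rank_mono) blast
  moreover have "signed_rank (U - F) \<le> card (U - F)"
    using \<open>U \<subseteq> edges G\<close> finite_edges finite_subset by (intro rank_le_card) blast
  ultimately show ?thesis
    using rank_Un_le[of F "U - F"] signed_rank_add_num_balanced[OF assms(2)] by linarith
qed

section \<open>Anti-Ramsey colourings\<close>

text \<open>The \<open>t\<close> disjoint subgraphs each spend \<open>num_balanced G F\<close> edges
  outside \<open>F\<close>. Contrapositively, too few such edges rule them out under every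
  colouring, including the injective one.\<close>

lemma has_disjoint_rainbow_imp_card_diff:
  assumes "has_disjoint_rainbow G c t" "F \<subseteq> edges G"
  shows "t * num_balanced G F \<le> card (edges G - F)"
proof -
  obtain U where U: "\<And>i. i < t \<Longrightarrow> signed_unicyclic G (U i)" "disjoint_family_on U {..<t}"
    using assms(1) unfolding has_disjoint_rainbow_def by blast
  have sub: "U i \<subseteq> edges G" if "i < t" for i
    using U(1)[OF that] by (simp add: signed_unicyclic_def)
  have fin: "finite (U i)" if "i < t" for i
    using sub[OF that] finite_edges finite_subset by blast
  have "t * num_balanced G F = (\<Sum>i<t. num_balanced G F)"
    by simp
  also have "\<dots> \<le> (\<Sum>i<t. card (U i - F))"
    using U(1) assms(2) by (intro sum_mono num_balanced_le_card_diff) auto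
  also have "\<dots> = card (\<Union>i<t. U i - F)"
    using U(2) fin by (intro card_UN_disjoint'[symmetric]) (auto simp: disjoint_family_on_def)
  also have "\<dots> \<le> card (edges G - F)"
    using sub finite_edges by (intro card_mono) auto
  finally show ?thesis .
qed

text \<open>
  Colour \<open>F\<close> and \<open>t * (num_balanced G F - 1) - 1\<close> further edges injectively, and all remaining
  edges with one extra colour, of which a rainbow subgraph contains at most one edge.
\<close>
lemma exists_coloring_without_disjoint_rainbow:
  assumes F: "F \<subseteq> edges G" "num_balanced G F \<ge> 2" "t \<ge> 1"
    and room: "t * num_balanced G F \<le> card (edges G) - card F"
  shows "\<exists>c :: 'e \<Rightarrow> nat. card (c ` edges G) = card F + t * (num_balanced G F - 1) \<and>
    \<not> has_disjoint_rainbow G c t"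
proof -
  define b where "b = num_balanced G F"
  \<comment> \<open>Positivity makes the later subtraction of one genuine.\<close>
  have "1 * 1 \<le> t * (b - 1)"
    using F by (intro mult_le_mono) (auto simp: b_def)
  then have pos: "1 \<le> t * (b - 1)"
    by simp
  have "t * (b - 1) + t = t * b"
    using F(2) by (cases b) (auto simp: b_def)
  have finF: "finite F"
    using F(1) finite_edges finite_subset by blast
  have card_diff: "card (edges G - F) = card (edges G) - card F"
    using F(1) finF by (simp add: card_Diff_subset)
  obtain D where D: "D \<subseteq> edges G - F" "card D = t * (b - 1) - 1"
    using obtain_subset_with_card_n[of "t * (b - 1) - 1" "edges G - F"] room card_diff \<open>t * (b - 1) + t = t * b\<close>
    by (metis b_def diff_le_self le_add1 le_trans)
  have finD: "finite D"
    using D(1) finite_edges finite_subset by blast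
  obtain g :: "'e \<Rightarrow> nat" where g: "inj_on g (F \<union> D)"
    using finite_imp_inj_to_nat_seg[of "F \<union> D"] finF finD by blast
  define c where "c e = (if e \<in> F \<union> D then Suc (g e) else 0)" for e
  \<comment> \<open>At least \<open>t + 1\<close> edges remain outside \<open>F \<union> D\<close>,
    so the extra colour \<open>0\<close> really occurs and is counted.\<close>
  have "card D < card (edges G - F)"
    using D(2) room card_diff pos \<open>t * (b - 1) + t = t * b\<close> unfolding b_def by linarith
  then have "D \<noteq> edges G - F"
    by blast
  then obtain e0 where "e0 \<in> edges G - (F \<union> D)"
    using D(1) by blast
  then have "c ` edges G = insert 0 (c ` (F \<union> D))"
    using F(1) D(1) by (auto simp: c_def image_iff)
  moreover have "inj_on c (F \<union> D)"
    using g by (auto simp: inj_on_def c_def)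
  then have "card (c ` (F \<union> D)) = card F + card D"
    using finF finD D(1) by (subst card_image) (auto intro: card_Un_disjoint)
  moreover have "0 \<notin> c ` (F \<union> D)"
    by (auto simp: c_def)
  ultimately have "card (c ` edges G) = Suc (card F + card D)"
    using finF finD by simp
  then have "card (c ` edges G) = card F + t * (b - 1)"
    unfolding D(2) using pos by linarith
  moreover have "\<not> has_disjoint_rainbow G c t"
  proof
    assume "has_disjoint_rainbow G c t"
    then obtain U where U: "\<And>i. i < t \<Longrightarrow> signed_unicyclic G (U i)" "\<And>i. i < t \<Longrightarrow> inj_on c (U i)"
      "disjoint_family_on U {..<t}"
      unfolding has_disjoint_rainbow_def rainbow_def by blast
    \<comment> \<open>A rainbow subgraph has at least \<open>b\<close> edges outside
      \<open>F\<close> and at most one of colour \<open>0\<close>. Hence \<open>t\<close> disjoint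
      ones need \<open>t * (b - 1)\<close> edges of \<open>D\<close>, one more than \<open>D\<close>
      has.\<close>
    have "b - 1 \<le> card (U i \<inter> D)" if i: "i < t" for i
    proof -
      have finU: "finite (U i)"
        using U(1)[OF i] finite_edges finite_subset by (auto simp: signed_unicyclic_def)
      have "b \<le> card (U i - F)"
        unfolding b_def using U(1)[OF i] F(1) by (rule num_balanced_le_card_diff)
      also have "\<dots> \<le> card ((U i \<inter> D) \<union> (U i - (F \<union> D)))"
        using finU by (intro card_mono) auto
      also have "\<dots> \<le> card (U i \<inter> D) + card (U i - (F \<union> D))"
        by (rule card_Un_le)
      also have "card (U i - (F \<union> D)) \<le> 1"
      proof -
        have "inj_on c (U i - (F \<union> D))"
          using U(2)[OF i] by (rule inj_on_subset) blast
        then have "card (U i - (F \<union> D)) = card (c ` (U i - (F \<union> D)))"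
          by (simp add: card_image)
        also have "\<dots> \<le> card {0 :: nat}"
          by (intro card_mono) (auto simp: c_def)
        finally show ?thesis
          by simp
      qed
      finally show ?thesis
        by simp
    qed
    then have "(\<Sum>i<t. b - 1) \<le> (\<Sum>i<t. card (U i \<inter> D))"
      by (intro sum_mono) simp
    also have "\<dots> = card (\<Union>i<t. U i \<inter> D)"
      using U(3) finD by (intro card_UN_disjoint'[symmetric]) (auto simp: disjoint_family_on_def)
    also have "\<dots> \<le> card D"
      using finD by (intro card_mono) auto
    finally have "t * (b - 1) \<le> t * (b - 1) - 1"
      by (simp only: D(2) sum_constant card_lessThan of_nat_id)
    then show False
      using pos by linarith
  qed
  ultimately show ?thesis
    unfolding b_def by blast
qed

lemma many_colors_imp_disjoint_rainbow:
  fixes c :: "'e \<Rightarrow> nat"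
  assumes "num_balanced G (edges G) = 0" "t \<ge> 1"
    and pack: "\<And>F. F \<subseteq> edges G \<Longrightarrow> t * num_balanced G F \<le> card (edges G) - card F"
    and many: "\<And>F. F \<subseteq> edges G \<Longrightarrow> num_balanced G F \<ge> 2 \<Longrightarrow>
      card F + t * (num_balanced G F - 1) < card (c ` edges G)"
  shows "has_disjoint_rainbow G c t"
proof -
  let ?E = "edges G" and ?n = "card (vertices G)"
  have mult: "t * ?n = t * signed_rank F + t * num_balanced G F" if "F \<subseteq> ?E" for F
    using signed_rank_add_num_balanced[OF that] by (metis distrib_left)
  have "\<exists>V. (\<forall>i<t. V i \<subseteq> ?E \<and> card (V i) = ?n \<and> signed_rank (V i) = ?n \<and> inj_on c (V i)) \<and>
    disjoint_family_on V {..<t}"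
  proof (rule disjoint_rainbow_bases)
    show "finite ?E"
      by (rule finite_edges)
    show "signed_rank A \<le> ?n" for A
      by (simp add: signed_rank_def)
    show "t * ?n \<le> t * signed_rank F + card (?E - F)" if F: "F \<subseteq> ?E" for F
      using mult[OF F] pack[OF F] F finite_edges by (simp add: card_Diff_subset finite_subset)
    show "t * ?n < t * signed_rank F + card (c ` (?E - F)) + t" if F: "F \<subseteq> ?E" for F
    proof -
      \<comment> \<open>The middle case uses that \<open>edges G\<close> has no balanced component:
        \<open>F\<close> is then a proper subset, and a single colour outside it suffices.\<close>
      consider "num_balanced G F = 0" | "num_balanced G F = 1" | "num_balanced G F \<ge> 2"
        by linarith
      then have "t * num_balanced G F < card (c ` (?E - F)) + t"
      proof cases
        case 1
        then show ?thesis
          using \<open>t \<ge> 1\<close> by simp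
      next
        case 2
        then have "F \<noteq> ?E"
          using assms(1) by auto
        then have "c ` (?E - F) \<noteq> {}" "finite (c ` (?E - F))"
          using F finite_edges by auto
        then have "0 < card (c ` (?E - F))"
          by (simp only: card_gt_0_iff) simp
        then show ?thesis
          using 2 by simp
      next
        case 3
        have finF: "finite F"
          using F finite_edges finite_subset by blast
        have "c ` ?E = c ` F \<union> c ` (?E - F)"
          using F by blast
        then have "card (c ` ?E) \<le> card (c ` F) + card (c ` (?E - F))"
          by (metis card_Un_le)
        also have "\<dots> \<le> card F + card (c ` (?E - F))"
          using card_image_le[OF finF] by simp
        finally have "t * (num_balanced G F - 1) < card (c ` (?E - F))"
          using many[OF F 3] by linarith
        moreover have "t * (num_balanced G F - 1) + t = t * num_balanced G F"
          using 3 by (cases "num_balanced G F") auto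
        ultimately show ?thesis
          by linarith
      qed
      then show ?thesis
        using mult[OF F] by linarith
    qed
    show "t \<ge> 1"
      by fact
  qed
  then obtain V where V: "\<And>i. i < t \<Longrightarrow> V i \<subseteq> ?E" "\<And>i. i < t \<Longrightarrow> card (V i) = ?n"
    "\<And>i. i < t \<Longrightarrow> signed_rank (V i) = ?n" "\<And>i. i < t \<Longrightarrow> inj_on c (V i)"
    "disjoint_family_on V {..<t}"
    by blast
  have "signed_unicyclic G (V i)" if i: "i < t" for i
  proof -
    have "num_balanced G (V i) = 0"
      using signed_rank_add_num_balanced[OF V(1)[OF i]] V(3)[OF i] by simp
    then show ?thesis
      using V(1,2)[OF i] by (intro basis_imp_signed_unicyclic)
  qed
  then show ?thesis
    using V unfolding has_disjoint_rainbow_def rainbow_def by blast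
qed

end

theorem theorem16:
  fixes G :: "('v, 'e) sgraph" and t :: nat
  assumes "signed_graph G"
    and "connected_graph G"
    and "card (vertices G) \<ge> 2"
    and "\<exists>C. negative_cycle G C"
    and "t \<ge> 1"
  shows "((\<exists>F0. F0 \<subseteq> edges G \<and> card (edges G) - card F0 < t * num_balanced G F0) \<longrightarrow>
            anti_ramsey G t = card (edges G)) \<and>
         (\<not> (\<exists>F0. F0 \<subseteq> edges G \<and> card (edges G) - card F0 < t * num_balanced G F0) \<longrightarrow>
            anti_ramsey G t =
              Max {card F + t * (num_balanced G F - 1) | F. F \<subseteq> edges G \<and> num_balanced G F \<ge> 2})"
proof -
  interpret finite_signed_graph G
    by unfold_locales fact
  let ?M = "{m. \<exists>c :: 'e \<Rightarrow> nat. card (c ` edges G) = m \<and> \<not> has_disjoint_rainbow G c t}"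
  let ?N = "{card F + t * (num_balanced G F - 1) | F. F \<subseteq> edges G \<and> num_balanced G F \<ge> 2}"
  have M_le: "m \<le> card (edges G)" if "m \<in> ?M" for m
    using that card_image_le[OF finite_edges] by auto
  then have finM: "finite ?M"
    by (meson finite_nat_set_iff_bounded_le)
  have "anti_ramsey G t = card (edges G)"
    if F: "F \<subseteq> edges G" "card (edges G) - card F < t * num_balanced G F" for F
  proof -
    obtain c :: "'e \<Rightarrow> nat" where "inj_on c (edges G)"
      using finite_imp_inj_to_nat_seg[OF finite_edges] by blast
    then have "card (c ` edges G) = card (edges G)"
      by (rule card_image)
    moreover have "\<not> has_disjoint_rainbow G c t"
      using has_disjoint_rainbow_imp_card_diff[of c t F] F finite_edges
      by (auto simp: card_Diff_subset finite_subset)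
    ultimately have "card (edges G) \<in> ?M"
      by blast
    then show ?thesis
      unfolding anti_ramsey_def using finM M_le by (intro Max_eqI) auto
  qed
  moreover have "anti_ramsey G t = Max ?N"
    if no: "\<not> (\<exists>F0. F0 \<subseteq> edges G \<and> card (edges G) - card F0 < t * num_balanced G F0)"
  proof -
    have pack: "t * num_balanced G F \<le> card (edges G) - card F" if "F \<subseteq> edges G" for F
      using no that by (meson not_le)
    have "?N = (\<lambda>F. card F + t * (num_balanced G F - 1)) ` {F. F \<subseteq> edges G \<and> num_balanced G F \<ge> 2}"
      by blast
    then have finN: "finite ?N"
      using finite_edges by simp
    \<comment> \<open>The empty edge set has every vertex as a balanced component, so two vertices
      make the maximum range over a nonempty set.\<close>
    have "card {} + t * (num_balanced G {} - 1) \<in> ?N"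
      unfolding mem_Collect_eq using assms(3) by (intro exI[of _ "{}"]) (simp add: num_balanced_empty)
    then have neN: "?N \<noteq> {}"
      by blast
    have NM: "?N \<subseteq> ?M"
      using exists_coloring_without_disjoint_rainbow[OF _ _ \<open>t \<ge> 1\<close> pack] by blast
    obtain C where "negative_cycle G C"
      using assms(4) by blast
    then have bE: "num_balanced G (edges G) = 0"
      using num_balanced_connected_unbalanced[OF assms(2)] by blast
    have "m \<le> Max ?N" if m: "m \<in> ?M" for m
    proof (rule ccontr)
      assume less: "\<not> m \<le> Max ?N"
      obtain c :: "'e \<Rightarrow> nat" where c: "card (c ` edges G) = m" "\<not> has_disjoint_rainbow G c t"
        using m by blast
      have "card F + t * (num_balanced G F - 1) < card (c ` edges G)"
        if "F \<subseteq> edges G" "num_balanced G F \<ge> 2" for F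
      proof -
        have "card F + t * (num_balanced G F - 1) \<in> ?N"
          using that by blast
        then have "card F + t * (num_balanced G F - 1) \<le> Max ?N"
          by (rule Max_ge[OF finN])
        then show ?thesis
          using less c(1) by linarith
      qed
      then show False
        using many_colors_imp_disjoint_rainbow[OF bE \<open>t \<ge> 1\<close> pack] c(2) by blast
    qed
    then show ?thesis
      unfolding anti_ramsey_def using finM NM Max_in[OF finN neN] by (intro Max_eqI) auto
  qed
  ultimately show ?thesis
    by blast
qed

end
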